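(* Let $N_2$ be the simply connected nilpotent Lie group whose Lie algebra has a basis of left invariant $1$-forms $\{e^1,\dots,e^7\}$ with $de^5=e^{12}$, $de^6=e^{13}$ and $de^i=0$ for $i=1,2,3,4,7$, and let $\varphi_2=e^{147}+e^{267}+e^{357}+e^{123}+e^{156}+e^{245}-e^{346}$ (a closed left invariant $G_2$ form). Let $f(t)=\big(\tfrac{10}{3}t+1\big)^{1/5}$. Then the family of closed $G_2$ forms $$\varphi_2(t)=e^{147}+e^{267}+e^{357}+f(t)^{3}e^{123}+e^{156}+e^{245}-e^{346},\qquad t\in\left(-\tfrac{3}{10},+\infty\right),$$ is the solution of the Laplacian flow of $\varphi_2$ on $N_2$. Moreover, the underlying metrics $g(t)=g_{\varphi_2(t)}$ converge smoothly, up to pull-back by time-dependent diffeomorphisms, to a flat metric, uniformly on compact sets in $N_2$, as $t\to+\infty$.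
   Context: A $G_2$ form on a $7$-manifold is a $3$-form which pointwise can be written as $e^{127}+e^{347}+e^{567}+e^{135}-e^{146}-e^{236}-e^{245}$ in some local coframe; it induces the metric $g_\varphi$ by $g_\varphi(X,Y)\,vol=\frac16\,\iota_X\varphi\wedge\iota_Y\varphi\wedge\varphi$ (and an orientation). The Laplacian flow of a closed $G_2$ form $\varphi$ is the system $\frac{d}{dt}\varphi(t)=\Delta_t\varphi(t)$, $d\varphi(t)=0$, $\varphi(0)=\varphi$, where $\Delta_t=dd^*+d^*d$ is the Hodge Laplacian of the metric $g_{\varphi(t)}$ (so $\Delta_t\varphi(t)=-d*_td*_t\varphi(t)$ for closed $\varphi(t)$). Here $e^{ijk}=e^i\wedge e^j\wedge e^k$. *)

theory Defs
  imports "HOL-Analysis.Analysis"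
begin

text \<open>Vectors of the Lie algebra (and tangent vectors of R^7) are elements of real^7.
  Index k in 1..7 of the paper is the element (k :: 7) of the numeral type 7
  (so index 7 is the element 7 = 0 of that type; the seven indices are distinct).
  A k-form is represented as a function of a sequence of vectors that depends only
  on the first k of them, is linear in each of them and alternating.\<close>

type_synonym form = "(nat \<Rightarrow> real^7) \<Rightarrow> real"

definition bv :: "7 \<Rightarrow> real^7" where "bv i = axis i 1"

definition is_form :: "nat \<Rightarrow> form \<Rightarrow> bool" where
  "is_form k w \<longleftrightarrow>
     (\<forall>vs ws. (\<forall>i<k. vs i = ws i) \<longrightarrow> w vs = w ws) \<and>
     (\<forall>i<k. \<forall>vs. linear (\<lambda>v. w (vs(i := v)))) \<and>
     (\<forall>vs i j. i < k \<and> j < k \<and> i \<noteq> j \<and> vs i = vs j \<longrightarrow> w vs = 0)"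

text \<open>Wedge product of a k-form and an l-form (determinant convention,
  so that e^{12}(e_1,e_2) = 1).\<close>
definition wedge :: "nat \<Rightarrow> nat \<Rightarrow> form \<Rightarrow> form \<Rightarrow> form" where
  "wedge k l a b = (\<lambda>vs. (1 / (fact k * fact l)) *
     (\<Sum>\<sigma>\<in>{\<sigma>. \<sigma> permutes {..<k+l}}.
        of_int (sign \<sigma>) * a (vs \<circ> \<sigma>) * b (\<lambda>i. vs (\<sigma> (i + k)))))"

definition covec :: "7 \<Rightarrow> form" where "covec i = (\<lambda>vs. vs 0 $ i)"

definition e2 :: "7 \<Rightarrow> 7 \<Rightarrow> form" where
  "e2 a b = wedge 1 1 (covec a) (covec b)"

definition e3 :: "7 \<Rightarrow> 7 \<Rightarrow> 7 \<Rightarrow> form" where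
  "e3 a b c = wedge 2 1 (e2 a b) (covec c)"

definition e1234567 :: form where
  "e1234567 = wedge 6 1 (wedge 5 1 (wedge 4 1 (wedge 3 1 (e3 1 2 3) (covec 4))
                 (covec 5)) (covec 6)) (covec 7)"

definition interior :: "real^7 \<Rightarrow> form \<Rightarrow> form" where
  "interior X w = (\<lambda>vs. w (\<lambda>i. case i of 0 \<Rightarrow> X | Suc j \<Rightarrow> vs j))"

definition phi0 :: form where
  "phi0 = (\<lambda>vs. e3 1 2 7 vs + e3 3 4 7 vs + e3 5 6 7 vs + e3 1 3 5 vs
                - e3 1 4 6 vs - e3 2 3 6 vs - e3 2 4 5 vs)"

definition is_G2_form :: "form \<Rightarrow> bool" where
  "is_G2_form w \<longleftrightarrow> (\<exists>P :: real^7^7. invertible P \<and>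
       (\<forall>vs. w vs = phi0 (\<lambda>i. P *v vs i)))"

text \<open>The symmetric bilinear form (1/6) i_X w ^ i_Y w ^ w, as a multiple of e^{1..7}.\<close>
definition Bphi :: "form \<Rightarrow> real^7 \<Rightarrow> real^7 \<Rightarrow> real" where
  "Bphi w X Y = (1/6) *
     wedge 4 3 (wedge 2 2 (interior X w) (interior Y w)) w
       (\<lambda>i. bv (of_nat (Suc i)))"

definition posdef_sym :: "real^7^7 \<Rightarrow> bool" where
  "posdef_sym g \<longleftrightarrow> transpose g = g \<and> (\<forall>X. X \<noteq> 0 \<longrightarrow> X \<bullet> (g *v X) > 0)"

text \<open>The metric g_phi (Gram matrix w.r.t. e_1..e_7) and orientation sign
  determined by g(X,Y) vol = (1/6) i_X w ^ i_Y w ^ w, vol = eps sqrt(det g) e^{1..7}.\<close>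
definition metric_of :: "form \<Rightarrow> real^7^7" where
  "metric_of w = (THE g. posdef_sym g \<and> (\<exists>\<epsilon>\<in>{-1, 1::real}.
      \<forall>X Y. (X \<bullet> (g *v Y)) * (\<epsilon> * sqrt (det g)) = Bphi w X Y))"

definition orient_of :: "form \<Rightarrow> real" where
  "orient_of w = (THE \<epsilon>. \<epsilon> \<in> {-1, 1} \<and>
      (\<forall>X Y. (X \<bullet> (metric_of w *v Y)) * (\<epsilon> * sqrt (det (metric_of w))) = Bphi w X Y))"

definition volume :: "real^7^7 \<Rightarrow> real \<Rightarrow> form" where
  "volume g \<epsilon> = (\<lambda>vs. \<epsilon> * sqrt (det g) * e1234567 vs)"

definition form_inner :: "real^7^7 \<Rightarrow> nat \<Rightarrow> form \<Rightarrow> form \<Rightarrow> real" where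
  "form_inner g k a b = (1 / fact k) *
     (\<Sum>I\<in>PiE {..<k} (\<lambda>_. UNIV). \<Sum>J\<in>PiE {..<k} (\<lambda>_. UNIV).
        (\<Prod>r<k. matrix_inv g $ I r $ J r) * a (\<lambda>r. bv (I r)) * b (\<lambda>r. bv (J r)))"

definition hodge :: "real^7^7 \<Rightarrow> real \<Rightarrow> nat \<Rightarrow> form \<Rightarrow> form" where
  "hodge g \<epsilon> k b = (THE h. is_form (7 - k) h \<and>
     (\<forall>a. is_form k a \<longrightarrow>
        (\<forall>vs. wedge k (7 - k) a h vs = form_inner g k a b * volume g \<epsilon> vs)))"

definition dE :: "7 \<Rightarrow> form" where
  "dE k = (if k = 5 then e2 1 2 else if k = 6 then e2 1 3 else (\<lambda>_. 0))"

text \<open>Lie bracket determined by d alpha(X,Y) = - alpha([X,Y]) for left invariant 1-forms.\<close>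
definition br :: "real^7 \<Rightarrow> real^7 \<Rightarrow> real^7" where
  "br X Y = (\<chi> k. - dE k (\<lambda>i. if i = 0 then X else Y))"

definition skip :: "nat \<Rightarrow> (nat \<Rightarrow> real^7) \<Rightarrow> nat \<Rightarrow> real^7" where
  "skip i vs = (\<lambda>r. if r < i then vs r else vs (Suc r))"

text \<open>Exterior derivative of a left invariant k-form (Chevalley-Eilenberg formula).\<close>
definition dext :: "nat \<Rightarrow> form \<Rightarrow> form" where
  "dext k w = (\<lambda>vs. \<Sum>i\<le>k. \<Sum>j\<in>{i<..k}.
      (-1) ^ (i + j) * w (\<lambda>r. case r of 0 \<Rightarrow> br (vs i) (vs j)
                                     | Suc r' \<Rightarrow> skip i (skip j vs) r'))"

text \<open>Hodge Laplacian of a closed G2 form: Delta w = - d * d * w for the metric of w.\<close>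
definition laplacian :: "form \<Rightarrow> form" where
  "laplacian w = (let g = metric_of w; \<epsilon> = orient_of w in
      (\<lambda>vs. - dext 2 (hodge g \<epsilon> 5 (dext 4 (hodge g \<epsilon> 3 w))) vs))"

definition laplacian_flow_solution :: "(real \<Rightarrow> form) \<Rightarrow> real set \<Rightarrow> form \<Rightarrow> bool" where
  "laplacian_flow_solution \<phi> I \<phi>\<^sub>0 \<longleftrightarrow> 0 \<in> I \<and> \<phi> 0 = \<phi>\<^sub>0 \<and>
     (\<forall>t\<in>I. is_G2_form (\<phi> t) \<and> is_form 3 (\<phi> t) \<and> dext 3 (\<phi> t) = (\<lambda>_. 0) \<and>
        (\<forall>vs. ((\<lambda>s. \<phi> s vs) has_real_derivative laplacian (\<phi> t) vs) (at t)))"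

text \<open>Global coordinates x on N_2 = R^7 with group law
  (a.x)_i = a_i + x_i (i <> 5,6), (a.x)_5 = a_5+x_5-a_1 x_2, (a.x)_6 = a_6+x_6-a_1 x_3.
  The left invariant coframe is e^i = dx^i (i <> 5,6), e^5 = dx^5 + x_1 dx^2,
  e^6 = dx^6 + x_1 dx^3; at the identity 0 it is the standard coframe.
  n2_coframe y v gives the values (e^1(v),...,e^7(v)) for v tangent at y.\<close>
definition n2_coframe :: "real^7 \<Rightarrow> real^7 \<Rightarrow> real^7" where
  "n2_coframe y v = (\<chi> a. if a = 5 then v $ 5 + y $ 1 * v $ 2
                          else if a = 6 then v $ 6 + y $ 1 * v $ 3 else v $ a)"

definition linv_metric :: "real^7^7 \<Rightarrow> real^7 \<Rightarrow> real^7 \<Rightarrow> real^7 \<Rightarrow> real" where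
  "linv_metric G y v w = n2_coframe y v \<bullet> (G *v n2_coframe y w)"

definition pd :: "7 \<Rightarrow> (real^7 \<Rightarrow> real) \<Rightarrow> real^7 \<Rightarrow> real" where
  "pd i f x = deriv (\<lambda>s. f (x + s *\<^sub>R axis i 1)) 0"

fun iter_pd :: "7 list \<Rightarrow> (real^7 \<Rightarrow> real) \<Rightarrow> real^7 \<Rightarrow> real" where
  "iter_pd [] f = f"
| "iter_pd (i # is) f = pd i (iter_pd is f)"

definition smooth_fun :: "(real^7 \<Rightarrow> real) \<Rightarrow> bool" where
  "smooth_fun f \<longleftrightarrow> (\<forall>is. continuous_on UNIV (iter_pd is f) \<and>
      (\<forall>i x. (\<lambda>s. iter_pd is f (x + s *\<^sub>R axis i 1)) differentiable (at 0)))"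

definition smooth_map :: "(real^7 \<Rightarrow> real^7) \<Rightarrow> bool" where
  "smooth_map F \<longleftrightarrow> (\<forall>k. smooth_fun (\<lambda>x. F x $ k))"

definition diffeo :: "(real^7 \<Rightarrow> real^7) \<Rightarrow> bool" where
  "diffeo F \<longleftrightarrow> bij F \<and> smooth_map F \<and> smooth_map (inv F)"

definition riem_metric :: "(real^7 \<Rightarrow> real^7^7) \<Rightarrow> bool" where
  "riem_metric h \<longleftrightarrow> (\<forall>i j. smooth_fun (\<lambda>x. h x $ i $ j)) \<and> (\<forall>x. posdef_sym (h x))"

definition christoffel :: "(real^7 \<Rightarrow> real^7^7) \<Rightarrow> 7 \<Rightarrow> 7 \<Rightarrow> 7 \<Rightarrow> real^7 \<Rightarrow> real" where
  "christoffel h k i j x = (1/2) * (\<Sum>l\<in>UNIV. matrix_inv (h x) $ k $ l *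
      (pd i (\<lambda>y. h y $ j $ l) x + pd j (\<lambda>y. h y $ i $ l) x - pd l (\<lambda>y. h y $ i $ j) x))"

definition riemann :: "(real^7 \<Rightarrow> real^7^7) \<Rightarrow> 7 \<Rightarrow> 7 \<Rightarrow> 7 \<Rightarrow> 7 \<Rightarrow> real^7 \<Rightarrow> real" where
  "riemann h l i j k x = pd i (christoffel h l j k) x - pd j (christoffel h l i k) x
     + (\<Sum>m\<in>UNIV. christoffel h l i m x * christoffel h m j k x
                 - christoffel h l j m x * christoffel h m i k x)"

definition flat_metric :: "(real^7 \<Rightarrow> real^7^7) \<Rightarrow> bool" where
  "flat_metric h \<longleftrightarrow> riem_metric h \<and> (\<forall>l i j k x. riemann h l i j k x = 0)"

definition pullback_metric :: "(real^7 \<Rightarrow> real^7) \<Rightarrow> (real^7 \<Rightarrow> real^7 \<Rightarrow> real^7 \<Rightarrow> real)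
    \<Rightarrow> real^7 \<Rightarrow> real^7^7" where
  "pullback_metric F g x = (\<chi> i j. g (F x) (\<chi> k. pd i (\<lambda>z. F z $ k) x) (\<chi> k. pd j (\<lambda>z. F z $ k) x))"

definition smooth_conv_compact :: "(real \<Rightarrow> real^7 \<Rightarrow> real^7^7) \<Rightarrow> (real^7 \<Rightarrow> real^7^7) \<Rightarrow> bool" where
  "smooth_conv_compact m h \<longleftrightarrow> (\<forall>K is i j. compact K \<longrightarrow>
      uniform_limit K (\<lambda>t. iter_pd is (\<lambda>y. m t y $ i $ j)) (iter_pd is (\<lambda>y. h y $ i $ j)) at_top)"

definition phi2 :: form where
  "phi2 = (\<lambda>vs. e3 1 4 7 vs + e3 2 6 7 vs + e3 3 5 7 vs + e3 1 2 3 vs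
                + e3 1 5 6 vs + e3 2 4 5 vs - e3 3 4 6 vs)"

definition f2 :: "real \<Rightarrow> real" where "f2 t = ((10/3) * t + 1) powr (1/5)"

definition phi2t :: "real \<Rightarrow> form" where
  "phi2t t = (\<lambda>vs. e3 1 4 7 vs + e3 2 6 7 vs + e3 3 5 7 vs + (f2 t) ^ 3 * e3 1 2 3 vs
                + e3 1 5 6 vs + e3 2 4 5 vs - e3 3 4 6 vs)"

end

theory Submission
  imports Defs "Jordan_Normal_Form.Determinant" "HOL-Real_Asymp.Real_Asymp"
begin

text \<open>In the coframe \<open>f e\<^sup>1, f e\<^sup>2, f e\<^sup>3, f\<^bsup>-1/2\<^esup> e\<^sup>4, \<dots>, f\<^bsup>-1/2\<^esup> e\<^sup>7\<close> the form \<open>\<phi>\<^sub>2(t)\<close> has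
  constant coefficients, so its metric is \<open>diag(f\<^sup>2, f\<^sup>2, f\<^sup>2, 1/f, 1/f, 1/f, 1/f)\<close>. The only term of
  \<open>*\<phi>\<^sub>2(t)\<close> that is not closed is \<open>f\<^bsup>-2\<^esup> e\<^bsup>4567\<^esup>\<close>, hence \<open>d*\<phi>\<^sub>2(t) = f\<^bsup>-2\<^esup> (e\<^bsup>13457\<^esup> - e\<^bsup>12467\<^esup>)\<close>,
  \<open>*d*\<phi>\<^sub>2(t) = f\<^bsup>-2\<^esup> (e\<^bsup>35\<^esup> - e\<^bsup>26\<^esup>)\<close> and \<open>\<Delta>\<phi>\<^sub>2(t) = 2 f\<^bsup>-2\<^esup> e\<^bsup>123\<^esup>\<close>. The flow thus reduces to
  \<open>(f\<^sup>3)' = 2 f\<^bsup>-2\<^esup>\<close>. Rescaling the coordinates by the inverses of the coframe factors turns the metric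
  into the Euclidean one up to terms of order \<open>f\<^bsup>-5/2\<^esup> x\<^sub>1\<close>, which vanish as \<open>f\<close> tends to infinity.\<close>

text \<open>Wedge products are sums over as many as 7! permutations, while metric, orientation and
  Hodge star are definite descriptions, so unfolding the definitions evaluates nothing. Two devices
  answer this. Forms are encoded as lists of coefficients and index lists (\<open>lin\<close>), on
  which wedge, contraction, \<open>dext\<close>, star and evaluation become list operations that the
  simplifier can run; the bridge is that a monomial is a determinant, which gives Laplace expansion.
  Each description is then settled by a candidate and a uniqueness argument: nondegeneracy of the
  wedge pairing for the star, a scaling argument for the metric. The function f comes from the
  reduced equation: 3 f^2 f' = 2 f^-2 means (f^5)' = 10/3, and f(0) = 1. For smooth convergence all
  iterated derivatives must converge. The rescaled entries are polynomials of degree at most 2 in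
  x_1, a class closed under derivatives, so it is enough that their coefficients converge.\<close>

no_notation Matrix.vec_index (infixl "$" 100)
hide_const (open) Determinant.det

section \<open>Monomial forms\<close>

text \<open>\<open>emono [i, j, \<dots>]\<close> is the form written \<open>e\<^bsup>ij\<dots>\<^esup>\<close> in the paper.\<close>
definition emono :: "7 list \<Rightarrow> form" where
  "emono xs = (\<lambda>vs. \<Sum>\<sigma> | \<sigma> permutes {..<length xs}.
     of_int (sign \<sigma>) * (\<Prod>r<length xs. vs (\<sigma> r) $ (xs ! r)))"

text \<open>Rows are indexed by the list, columns by the vectors. This makes Laplace expansion, row
  permutation, transposition and the vanishing for equal rows or columns available for
  monomials.\<close>

lemma emono_eq_det:
  "emono xs vs = Determinant.det
     (Matrix.mat (length xs) (length xs) (\<lambda>(i, j). vs j $ (xs ! i)))"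
  unfolding emono_def Determinant.det_def
  by (auto simp: atLeast0LessThan permutes_in_image intro!: sum.cong prod.cong)

lemma emono_cong:
  assumes "\<And>i. i < length xs \<Longrightarrow> vs i = ws i"
  shows "emono xs vs = emono xs ws"
proof -
  have "vs (\<sigma> r) = ws (\<sigma> r)" if "\<sigma> permutes {..<length xs}" "r < length xs" for \<sigma> r
    using assms permutes_in_image[OF that(1), of r] that(2) by simp
  then show ?thesis unfolding emono_def by simp
qed

lemma emono_Nil [simp]: "emono [] vs = 1"
  by (simp add: emono_def)

text \<open>Laplace expansion along the first row. Deleting column j is \<open>skip j\<close>. Later
  computations use this recursion in place of the sum over permutations.\<close>

lemma emono_Cons:
  "emono (x # xs) vs = (\<Sum>j\<le>length xs. (-1) ^ j * vs j $ x * emono xs (skip j vs))"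
proof -
  let ?n = "length xs"
  let ?A = "Matrix.mat (Suc ?n) (Suc ?n) (\<lambda>(i, j). vs j $ ((x # xs) ! i))"
  have A: "?A \<in> carrier_mat (Suc ?n) (Suc ?n)" by simp
  have "Determinant.det (mat_delete ?A 0 j) = emono xs (skip j vs)" if "j \<le> ?n" for j
    unfolding emono_eq_det mat_delete_def
    by (rule arg_cong[where f = Determinant.det]) (auto intro!: eq_matI simp: skip_def)
  then show ?thesis
    unfolding emono_eq_det[of "x # xs"] length_Cons laplace_expansion_row[OF A zero_less_Suc]
    by (intro sum.cong) (auto simp: cofactor_def)
qed

lemma emono_not_distinct: "\<not> distinct xs \<Longrightarrow> emono xs = (\<lambda>_. 0)"
proof (rule ext)
  fix vs assume "\<not> distinct xs"
  then obtain i j where ij: "i < length xs" "j < length xs" "i \<noteq> j" "xs ! i = xs ! j"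
    by (auto simp: distinct_conv_nth)
  show "emono xs vs = 0"
    unfolding emono_eq_det
    by (rule det_identical_rows[OF _ ij(3,1,2)]) (use ij in \<open>auto intro!: eq_vecI\<close>)
qed

lemma emono_permute_list:
  assumes "p permutes {..<length xs}"
  shows "emono (permute_list p xs) vs = of_int (sign p) * emono xs vs"
proof -
  let ?n = "length xs"
  let ?A = "Matrix.mat ?n ?n (\<lambda>(i, j). vs j $ (xs ! i))"
  have A: "?A \<in> carrier_mat ?n ?n" by simp
  have p: "p permutes {0..<?n}" using assms by (simp add: atLeast0LessThan)
  have "p i < ?n" if "i < ?n" for i
    using permutes_in_image[OF assms, of i] that by simp
  then have "Matrix.mat ?n ?n (\<lambda>(i, j). vs j $ (permute_list p xs ! i))
      = Matrix.mat ?n ?n (\<lambda>(i, j). ?A $$ (p i, j))"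
    by (intro eq_matI) (simp_all add: permute_list_nth[OF assms])
  then show ?thesis
    using det_permute_rows[OF A p] by (simp add: emono_eq_det)
qed

lemma skip_fun_upd_same [simp]: "skip i (vs(i := v)) = skip i vs"
  by (auto simp: skip_def)

lemma skip_fun_upd_other:
  "i \<noteq> j \<Longrightarrow> skip j (vs(i := v)) = (skip j vs)((if i < j then i else i - 1) := v)"
  by (auto simp: skip_def fun_eq_iff)

lemma emono_linear: "i < length xs \<Longrightarrow> linear (\<lambda>v. emono xs (vs(i := v)))"
proof (induction xs arbitrary: i vs)
  case (Cons x xs)
  have "linear (\<lambda>v. (-1) ^ j * (vs(i := v)) j $ x * emono xs (skip j (vs(i := v))))"
    if "j \<le> length xs" for j
  proof (cases "j = i")
    case True
    then show ?thesis
      by (auto intro!: linearI simp: algebra_simps)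
  next
    case False
    \<comment> \<open>Slot i moves down by one when a slot before it is deleted; in the term j = i
      it disappears from the minor, which leaves only the linear factor.\<close>
    define m where "m = (if i < j then i else i - 1)"
    have "m < length xs" using False that Cons.prems by (auto simp: m_def)
    from linear_compose[OF Cons.IH[OF this, of "skip j vs"] linear_times[of "(-1) ^ j * vs j $ x"]]
    have "linear (\<lambda>v. (-1) ^ j * vs j $ x * emono xs ((skip j vs)(m := v)))"
      unfolding comp_def .
    moreover have "skip j (vs(i := v)) = (skip j vs)(m := v)" for v
      unfolding m_def using False by (simp add: skip_fun_upd_other)
    ultimately show ?thesis using False by simp
  qed
  then show ?case
    unfolding emono_Cons by (intro linear_compose_sum) auto
qed simp

lemma is_form_emono: "is_form (length xs) (emono xs)"
  unfolding is_form_def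
proof (intro conjI allI impI)
  fix vs :: "nat \<Rightarrow> real^7" and i j :: nat
  assume ij: "i < length xs \<and> j < length xs \<and> i \<noteq> j \<and> vs i = vs j"
  show "emono xs vs = 0"
    unfolding emono_eq_det
    by (rule det_identical_columns[of _ _ i j]) (use ij in \<open>auto intro!: eq_vecI\<close>)
next
  fix vs ws :: "nat \<Rightarrow> real^7" assume "\<forall>i<length xs. vs i = ws i"
  then show "emono xs vs = emono xs ws" by (intro emono_cong) blast
qed (rule emono_linear)

lemma wedge_linear_left:
  "finite A \<Longrightarrow> wedge k l (\<lambda>vs. \<Sum>i\<in>A. c i * a i vs) b vs = (\<Sum>i\<in>A. c i * wedge k l (a i) b vs)"
  unfolding wedge_def sum_distrib_left sum_distrib_right
  by (subst sum.swap) (simp add: mult_ac)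

lemma wedge_linear_right:
  "finite A \<Longrightarrow> wedge k l b (\<lambda>vs. \<Sum>i\<in>A. c i * a i vs) vs = (\<Sum>i\<in>A. c i * wedge k l b (a i) vs)"
  unfolding wedge_def sum_distrib_left sum_distrib_right
  by (subst sum.swap) (simp add: mult_ac)

text \<open>Expanding both factors gives a triple sum over \<sigma>, \<tau>, \<rho>. For fixed
  \<tau> and \<rho>, substituting \<sigma> composed with the block permutation built from them shows
  that the sum over \<sigma> does not depend on the pair. The k! l! equal contributions cancel the
  normalising factor of \<open>wedge\<close>.\<close>

lemma wedge_emono:
  "wedge (length xs) (length ys) (emono xs) (emono ys) = emono (xs @ ys)"
proof
  fix vs :: "nat \<Rightarrow> real^7"
  let ?k = "length xs" and ?l = "length ys"
  let ?S = "{\<sigma>. \<sigma> permutes {..<?k + ?l}}"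
  let ?K = "{\<sigma>. \<sigma> permutes {..<?k}}" and ?L = "{\<sigma>. \<sigma> permutes {..<?l}}"
  let ?F = "\<lambda>\<sigma>. (\<Prod>r<?k. vs (\<sigma> r) $ (xs ! r)) * (\<Prod>r<?l. vs (\<sigma> (r + ?k)) $ (ys ! r))"
  let ?T = "\<Sum>\<sigma>\<in>?S. of_int (sign \<sigma>) * ?F \<sigma> :: real"
  define sh where "sh = (\<lambda>\<rho>. map_permutation {..<?l} (\<lambda>r. r + ?k) \<rho>)"
  have inj: "inj_on (\<lambda>r. r + ?k) {..<?l}" by (auto simp: inj_on_def)
  have im: "(\<lambda>r. r + ?k) ` {..<?l} = {?k..<?k + ?l}"
    by (simp add: lessThan_atLeast0 add.commute)
  have key: "(\<Sum>\<sigma>\<in>?S. of_int (sign \<sigma>) * (of_int (sign \<tau>) * (\<Prod>r<?k. vs (\<sigma> (\<tau> r)) $ (xs ! r)))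
       * (of_int (sign \<rho>) * (\<Prod>r<?l. vs (\<sigma> (\<rho> r + ?k)) $ (ys ! r)))) = ?T"
    if \<tau>: "\<tau> permutes {..<?k}" and \<rho>: "\<rho> permutes {..<?l}" for \<tau> \<rho>
  proof -
    have sh: "sh \<rho> permutes {?k..<?k + ?l}"
      unfolding sh_def using \<rho> inj im by (intro map_permutation_permutes) (auto simp: bij_betw_def)
    have sh_ap: "sh \<rho> (r + ?k) = \<rho> r + ?k" if "r < ?l" for r
      unfolding sh_def using map_permutation_apply[OF inj, of r] that by simp
    have sh': "sh \<rho> permutes {..<?k + ?l}" by (rule permutes_subset[OF sh]) auto
    have \<tau>': "\<tau> permutes {..<?k + ?l}" by (rule permutes_subset[OF \<tau>]) auto
    \<comment> \<open>Acts as \<tau> on the first block and as \<rho>, shifted by \<open>?k\<close>,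
      on the second; its sign is the product of the two signs.\<close>
    let ?\<pi> = "\<tau> \<circ> sh \<rho>"
    have \<pi>: "?\<pi> permutes {..<?k + ?l}" by (rule permutes_compose[OF sh' \<tau>'])
    have p\<tau>: "permutation \<tau>" and psh: "permutation (sh \<rho>)" and p\<pi>: "permutation ?\<pi>"
      using \<tau>' sh' \<pi> by (auto intro: permutes_imp_permutation[OF finite_lessThan])
    have s\<pi>: "sign ?\<pi> = sign \<tau> * sign \<rho>"
      using sign_compose[OF p\<tau> psh] sign_map_permutation[OF inj \<rho>] by (simp add: sh_def)
    have a1: "?\<pi> r = \<tau> r" if "r < ?k" for r
      using permutes_not_in[OF sh, of r] that by simp
    have a2: "?\<pi> (r + ?k) = \<rho> r + ?k" if "r < ?l" for r
      using permutes_not_in[OF \<tau>, of "\<rho> r + ?k"] sh_ap[OF that] by simp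
    have "?T = (\<Sum>\<sigma>\<in>?S. of_int (sign (\<sigma> \<circ> ?\<pi>)) * ?F (\<sigma> \<circ> ?\<pi>))"
      by (rule sum_permutations_compose_right[OF \<pi>])
    also have "\<dots> = (\<Sum>\<sigma>\<in>?S. of_int (sign \<sigma>) * (of_int (sign \<tau>) * (\<Prod>r<?k. vs (\<sigma> (\<tau> r)) $ (xs ! r)))
       * (of_int (sign \<rho>) * (\<Prod>r<?l. vs (\<sigma> (\<rho> r + ?k)) $ (ys ! r))))"
    proof (rule sum.cong[OF refl])
      fix \<sigma> assume "\<sigma> \<in> ?S"
      then have p\<sigma>: "permutation \<sigma>" by (auto intro: permutes_imp_permutation[OF finite_lessThan])
      have "?F (\<sigma> \<circ> ?\<pi>) = (\<Prod>r<?k. vs (\<sigma> (\<tau> r)) $ (xs ! r)) * (\<Prod>r<?l. vs (\<sigma> (\<rho> r + ?k)) $ (ys ! r))"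
        using a1 a2 by (intro arg_cong2[where f = "(*)"] prod.cong) auto
      then show "of_int (sign (\<sigma> \<circ> ?\<pi>)) * ?F (\<sigma> \<circ> ?\<pi>)
        = of_int (sign \<sigma>) * (of_int (sign \<tau>) * (\<Prod>r<?k. vs (\<sigma> (\<tau> r)) $ (xs ! r)))
       * (of_int (sign \<rho>) * (\<Prod>r<?l. vs (\<sigma> (\<rho> r + ?k)) $ (ys ! r)))"
        using sign_compose[OF p\<sigma> p\<pi>] s\<pi> by simp
    qed
    finally show ?thesis by simp
  qed
  have "(\<Sum>\<sigma>\<in>?S. of_int (sign \<sigma>) * emono xs (vs \<circ> \<sigma>) * emono ys (\<lambda>i. vs (\<sigma> (i + ?k))))
    = (\<Sum>\<sigma>\<in>?S. \<Sum>\<tau>\<in>?K. \<Sum>\<rho>\<in>?L. of_int (sign \<sigma>) * (of_int (sign \<tau>) * (\<Prod>r<?k. vs (\<sigma> (\<tau> r)) $ (xs ! r)))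
       * (of_int (sign \<rho>) * (\<Prod>r<?l. vs (\<sigma> (\<rho> r + ?k)) $ (ys ! r))))"
    unfolding emono_def by (simp add: sum_distrib_left sum_distrib_right mult_ac)
  also have "\<dots> = (\<Sum>\<tau>\<in>?K. \<Sum>\<sigma>\<in>?S. \<Sum>\<rho>\<in>?L. of_int (sign \<sigma>) * (of_int (sign \<tau>) * (\<Prod>r<?k. vs (\<sigma> (\<tau> r)) $ (xs ! r)))
       * (of_int (sign \<rho>) * (\<Prod>r<?l. vs (\<sigma> (\<rho> r + ?k)) $ (ys ! r))))"
    by (rule sum.swap)
  also have "\<dots> = (\<Sum>\<tau>\<in>?K. \<Sum>\<rho>\<in>?L. \<Sum>\<sigma>\<in>?S. of_int (sign \<sigma>) * (of_int (sign \<tau>) * (\<Prod>r<?k. vs (\<sigma> (\<tau> r)) $ (xs ! r)))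
       * (of_int (sign \<rho>) * (\<Prod>r<?l. vs (\<sigma> (\<rho> r + ?k)) $ (ys ! r))))"
    by (rule sum.cong[OF refl], rule sum.swap)
  also have "\<dots> = (\<Sum>\<tau>\<in>?K. \<Sum>\<rho>\<in>?L. ?T)"
    by (intro sum.cong refl key) auto
  also have "\<dots> = fact ?k * fact ?l * ?T"
    by (simp add: card_permutations[OF refl])
  finally have "wedge ?k ?l (emono xs) (emono ys) vs = ?T"
    unfolding wedge_def by simp
  also have "?T = emono (xs @ ys) vs"
  proof -
    have "(\<Prod>r<?k + ?l. vs (\<sigma> r) $ ((xs @ ys) ! r)) = ?F \<sigma>" for \<sigma>
    proof -
      have split: "{..<?k + ?l} = {..<?k} \<union> {?k..<?k + ?l}" by auto
      have "(\<Prod>r<?k + ?l. vs (\<sigma> r) $ ((xs @ ys) ! r))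
        = (\<Prod>r<?k. vs (\<sigma> r) $ ((xs @ ys) ! r)) * (\<Prod>r\<in>{?k..<?k + ?l}. vs (\<sigma> r) $ ((xs @ ys) ! r))"
        unfolding split by (rule prod.union_disjoint) auto
      also have "(\<Prod>r\<in>{?k..<?k + ?l}. vs (\<sigma> r) $ ((xs @ ys) ! r))
          = (\<Prod>r<?l. vs (\<sigma> (r + ?k)) $ ((xs @ ys) ! (r + ?k)))"
        unfolding im[symmetric] by (subst prod.reindex[OF inj]) simp
      finally show ?thesis by (simp add: nth_append)
    qed
    then show ?thesis unfolding emono_def by simp
  qed
  finally show "wedge ?k ?l (emono xs) (emono ys) vs = emono (xs @ ys) vs" .
qed

section \<open>Expansion of alternating forms\<close>

lemma is_form_cong: "is_form k w \<Longrightarrow> (\<And>i. i < k \<Longrightarrow> vs i = ws i) \<Longrightarrow> w vs = w ws"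
  unfolding is_form_def by blast

lemma is_form_linear: "is_form k w \<Longrightarrow> i < k \<Longrightarrow> linear (\<lambda>v. w (vs(i := v)))"
  unfolding is_form_def by blast

lemma is_form_alternating:
  "is_form k w \<Longrightarrow> i < k \<Longrightarrow> j < k \<Longrightarrow> i \<noteq> j \<Longrightarrow> vs i = vs j \<Longrightarrow> w vs = 0"
  unfolding is_form_def by blast

text \<open>Polarisation: the alternating condition is applied to a + b placed in both
  slots.\<close>

lemma is_form_transpose:
  assumes w: "is_form k w" and ij: "i < k" "j < k" "i \<noteq> j"
  shows "w (vs \<circ> Transposition.transpose i j) = - w vs"
proof -
  define W where "W a b = w (vs(i := a, j := b))" for a b
  have l1: "linear (\<lambda>a. W a b)" for b
    using is_form_linear[OF w ij(1), of "vs(j := b)"] ij(3) by (simp add: W_def fun_upd_twist)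
  have l2: "linear (\<lambda>b. W a b)" for a
    using is_form_linear[OF w ij(2), of "vs(i := a)"] by (simp add: W_def)
  have z: "W a a = 0" for a
    unfolding W_def using ij by (intro is_form_alternating[OF w ij]) auto
  let ?a = "vs i" and ?b = "vs j"
  have "W (?a + ?b) (?a + ?b) = W ?a ?a + W ?a ?b + W ?b ?a + W ?b ?b"
    by (simp add: linear_add[OF l1] linear_add[OF l2])
  then have "W ?b ?a = - W ?a ?b" by (simp add: z)
  moreover have "vs(i := ?b, j := ?a) = vs \<circ> Transposition.transpose i j"
    by (auto simp: fun_eq_iff Transposition.transpose_def)
  ultimately show ?thesis by (simp add: W_def)
qed

lemma is_form_permute:
  assumes w: "is_form k w" and \<sigma>: "\<sigma> permutes {..<k}"
  shows "w (vs \<circ> \<sigma>) = of_int (sign \<sigma>) * w vs"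
  using finite_lessThan \<sigma>
proof (induction arbitrary: vs rule: permutes_rev_induct)
  case (swap a b p)
  show ?case
  proof (cases "a = b")
    case True
    then show ?thesis using swap by simp
  next
    case False
    have "permutation p" using swap permutes_imp_permutation by blast
    then have s: "sign (p \<circ> Transposition.transpose a b) = - sign p"
      using False by (simp add: sign_compose permutation_swap_id sign_swap_id)
    have "w (vs \<circ> p \<circ> Transposition.transpose a b) = - w (vs \<circ> p)"
      using swap.hyps by (intro is_form_transpose[OF w _ _ False]) auto
    then show ?thesis
      unfolding s using swap.IH[of vs] by (simp add: comp_def)
  qed
qed simp

text \<open>Multilinearity is used one slot at a time: the first m arguments are already basis
  vectors, the others are still arbitrary.\<close>

lemma is_form_expand_upto:
  assumes w: "is_form k w"
  shows "m \<le> k \<Longrightarrow> w vs = (\<Sum>I\<in>PiE {..<m} (\<lambda>_. UNIV).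
     (\<Prod>r<m. vs r $ I r) * w (\<lambda>r. if r < m then bv (I r) else vs r))"
proof (induction m)
  case 0
  then show ?case by simp
next
  case (Suc m)
  have ex: "w us = (\<Sum>i\<in>UNIV. us m $ i * w (us(m := bv i)))" for us
  proof -
    have "w us = w (us(m := \<Sum>i\<in>UNIV. us m $ i *\<^sub>R bv i))"
      using basis_expansion[of "us m"] by (simp add: bv_def scalar_mult_eq_scaleR)
    also have "\<dots> = (\<Sum>i\<in>UNIV. us m $ i * w (us(m := bv i)))"
    proof -
      have lin: "linear (\<lambda>v. w (us(m := v)))" using Suc.prems by (intro is_form_linear[OF w]) simp
      show ?thesis
        using linear_sum[OF lin, of "\<lambda>i. us m $ i *\<^sub>R bv i" UNIV] by (simp add: linear_cmul[OF lin])
    qed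
    finally show ?thesis .
  qed
  have upd: "(\<lambda>r. if r < m then bv (I r) else vs r)(m := bv i)
      = (\<lambda>r. if r < Suc m then bv ((I(m := i)) r) else vs r)" for I i
    by (auto simp: fun_eq_iff less_Suc_eq)
  have "w vs = (\<Sum>I\<in>PiE {..<m} (\<lambda>_. UNIV). \<Sum>i\<in>UNIV. (\<Prod>r<Suc m. vs r $ (I(m := i)) r) *
      w (\<lambda>r. if r < Suc m then bv ((I(m := i)) r) else vs r))"
  proof -
    have "(\<Prod>r<m. vs r $ I r) * w (\<lambda>r. if r < m then bv (I r) else vs r)
      = (\<Sum>i\<in>UNIV. (\<Prod>r<Suc m. vs r $ (I(m := i)) r) *
          w (\<lambda>r. if r < Suc m then bv ((I(m := i)) r) else vs r))" for I
      unfolding ex[of "\<lambda>r. if r < m then bv (I r) else vs r"] upd sum_distrib_left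
      by (intro sum.cong refl) simp
    then show ?thesis using Suc by simp
  qed
  also have "\<dots> = (\<Sum>(i, I)\<in>UNIV \<times> PiE {..<m} (\<lambda>_. UNIV). (\<Prod>r<Suc m. vs r $ (I(m := i)) r) *
      w (\<lambda>r. if r < Suc m then bv ((I(m := i)) r) else vs r))"
    by (subst sum.swap) (rule sum.cartesian_product)
  also have "\<dots> = (\<Sum>I\<in>(\<lambda>(i, I). I(m := i)) ` (UNIV \<times> PiE {..<m} (\<lambda>_. UNIV)). (\<Prod>r<Suc m. vs r $ I r) *
      w (\<lambda>r. if r < Suc m then bv (I r) else vs r))"
  proof (subst sum.reindex)
    show "inj_on (\<lambda>(i, I). I(m := i)) (UNIV \<times> PiE {..<m} (\<lambda>_. UNIV))"
      by (rule inj_combinator) simp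
  qed (auto intro!: sum.cong simp del: fun_upd_apply)
  also have "(\<lambda>(i, I). I(m := i)) ` (UNIV \<times> PiE {..<m} (\<lambda>_. UNIV)) = PiE {..<Suc m} (\<lambda>_. UNIV :: 7 set)"
    by (simp add: lessThan_Suc PiE_insert_eq)
  finally show ?case .
qed

lemma is_form_expand:
  assumes "is_form k w"
  shows "w vs = (\<Sum>I\<in>PiE {..<k} (\<lambda>_. UNIV). (\<Prod>r<k. vs r $ I r) * w (\<lambda>r. bv (I r)))"
proof -
  have "w (\<lambda>r. if r < k then bv (I r) else vs r) = w (\<lambda>r. bv (I r))" for I
    by (rule is_form_cong[OF assms]) simp
  then show ?thesis
    using is_form_expand_upto[OF assms order_refl, of vs] by simp
qed

lemma is_form_eqI:
  assumes "is_form k v" "is_form k w" and "\<And>I. v (\<lambda>r. bv (I r)) = w (\<lambda>r. bv (I r))"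
  shows "v = w"
proof
  fix vs
  show "v vs = w vs"
    unfolding is_form_expand[OF assms(1), of vs] is_form_expand[OF assms(2), of vs] assms(3) ..
qed

text \<open>The basis expansion is averaged over all signed permutations of the arguments. The sum
  runs over all index functions rather than increasing ones, which accounts for the division by
  k!.\<close>

lemma is_form_eq_sum_emono:
  assumes w: "is_form k w"
  shows "w vs = (\<Sum>I\<in>PiE {..<k} (\<lambda>_. UNIV). (w (\<lambda>r. bv (I r)) / fact k) * emono (map I [0..<k]) vs)"
proof -
  let ?S = "{\<sigma>. \<sigma> permutes {..<k}}" and ?P = "PiE {..<k} (\<lambda>_. UNIV :: 7 set)"
  have sq: "of_int (sign \<sigma>) * of_int (sign \<sigma>) = (1::real)" for \<sigma> :: "nat \<Rightarrow> nat"
    by (simp add: sign_def)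
  have "fact k * w vs = (\<Sum>\<sigma>\<in>?S. w vs)"
    by (simp add: card_permutations[OF refl])
  also have "\<dots> = (\<Sum>\<sigma>\<in>?S. of_int (sign \<sigma>) * w (vs \<circ> \<sigma>))"
    using is_form_permute[OF w] sq by (intro sum.cong) (simp_all add: mult.assoc[symmetric])
  also have "\<dots> = (\<Sum>\<sigma>\<in>?S. \<Sum>I\<in>?P. of_int (sign \<sigma>) * ((\<Prod>r<k. vs (\<sigma> r) $ I r) * w (\<lambda>r. bv (I r))))"
    by (subst is_form_expand[OF w, of "vs \<circ> _"]) (simp add: sum_distrib_left)
  also have "\<dots> = (\<Sum>I\<in>?P. \<Sum>\<sigma>\<in>?S. of_int (sign \<sigma>) * ((\<Prod>r<k. vs (\<sigma> r) $ I r) * w (\<lambda>r. bv (I r))))"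
    by (rule sum.swap)
  also have "\<dots> = (\<Sum>I\<in>?P. w (\<lambda>r. bv (I r)) * emono (map I [0..<k]) vs)"
    by (simp add: emono_def sum_distrib_left mult_ac)
  also have "\<dots> = fact k * (\<Sum>I\<in>?P. (w (\<lambda>r. bv (I r)) / fact k) * emono (map I [0..<k]) vs)"
    by (simp add: sum_distrib_left)
  finally show ?thesis by simp
qed

section \<open>The index type and monomials of low degree\<close>

lemma exhaust_7:
  fixes x :: 7
  shows "x = 1 \<or> x = 2 \<or> x = 3 \<or> x = 4 \<or> x = 5 \<or> x = 6 \<or> x = 7"
proof (induct x)
  case (of_int z)
  \<comment> \<open>Representatives run from 0 to 6; the case z = 0 is the index 7, because 7 = 0 in
    this type.\<close>
  then have "z = 0 \<or> z = 1 \<or> z = 2 \<or> z = 3 \<or> z = 4 \<or> z = 5 \<or> z = 6"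
    by simp arith
  then show ?case by auto
qed

lemma UNIV_7: "UNIV = {1, 2, 3, 4, 5, 6, 7 :: 7}"
  using exhaust_7 by auto

lemma forall_7: "(\<forall>i::7. P i) \<longleftrightarrow> P 1 \<and> P 2 \<and> P 3 \<and> P 4 \<and> P 5 \<and> P 6 \<and> P 7"
  by (metis exhaust_7)

lemma sum_7: "sum f (UNIV :: 7 set) = f 1 + f 2 + f 3 + f 4 + f 5 + f 6 + f 7"
  unfolding UNIV_7 by (simp add: add_ac)

lemma emono_2: "emono [a, b] vs = vs 0 $ a * vs 1 $ b - vs 1 $ a * vs 0 $ b"
  by (simp add: emono_Cons skip_def)

lemma covec_eq_emono: "covec a = emono [a]"
  by (simp add: emono_Cons covec_def fun_eq_iff)

lemma e2_eq_emono: "e2 a b = emono [a, b]"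
  using wedge_emono[of "[a]" "[b]"] by (simp add: e2_def covec_eq_emono)

lemma e3_eq_emono: "e3 a b c = emono [a, b, c]"
  using wedge_emono[of "[a, b]" "[c]"] by (simp add: e3_def e2_eq_emono covec_eq_emono numeral_2_eq_2)

lemma e1234567_eq_emono: "e1234567 = emono [1, 2, 3, 4, 5, 6, 7]"
  using wedge_emono[of "[1, 2, 3]" "[4]"] wedge_emono[of "[1, 2, 3, 4]" "[5]"]
    wedge_emono[of "[1, 2, 3, 4, 5]" "[6]"] wedge_emono[of "[1, 2, 3, 4, 5, 6]" "[7]"]
  by (simp add: e1234567_def e3_eq_emono covec_eq_emono eval_nat_numeral)

section \<open>Contraction and exterior derivative of monomials\<close>

text \<open>A formal linear combination of monomials. Lists are not normalised: repeated indices,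
  unsorted indices and zero coefficients are all allowed.\<close>

definition lin :: "(real \<times> 7 list) list \<Rightarrow> form" where
  "lin L = (\<lambda>vs. \<Sum>(c, xs)\<leftarrow>L. c * emono xs vs)"

lemma lin_Nil [simp]: "lin [] vs = 0"
  and lin_Cons [simp]: "lin (p # L) vs = fst p * emono (snd p) vs + lin L vs"
  and lin_append [simp]: "lin (L @ M) vs = lin L vs + lin M vs"
  by (simp_all add: lin_def case_prod_beta)

lemma lin_Cons_index:
  "\<forall>p\<in>set L. length (snd p) = n \<Longrightarrow>
   lin (map (\<lambda>(c, ys). (c, x # ys)) L) vs = (\<Sum>j\<le>n. (-1) ^ j * vs j $ x * lin L (skip j vs))"
  by (induction L) (auto simp: emono_Cons sum_distrib_left sum.distrib algebra_simps)

lemma lin_uminus: "lin (map (\<lambda>(c, ys). (- c, f ys)) L) vs = - lin (map (\<lambda>(c, ys). (c, f ys)) L) vs"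
  by (induction L) auto

text \<open>The antiderivation rule: contracting e^x wedge w gives X_x w minus e^x wedge the
  contraction of w.\<close>

fun contr :: "real^7 \<Rightarrow> 7 list \<Rightarrow> (real \<times> 7 list) list" where
  "contr X [] = []"
| "contr X (x # xs) = (X $ x, xs) # map (\<lambda>(c, ys). (- c, x # ys)) (contr X xs)"

lemma length_contr: "\<forall>p\<in>set (contr X xs). Suc (length (snd p)) = length xs"
  by (induction xs) auto

lemma skip_case_nat [simp]:
  "skip 0 (case_nat X vs) = vs" "skip (Suc j) (case_nat X vs) = case_nat X (skip j vs)"
  by (auto simp: skip_def fun_eq_iff split: nat.splits)

lemma interior_eq: "interior X w vs = w (case_nat X vs)"
  by (simp add: interior_def)

text \<open>In the Laplace expansion X sits in slot 0. The term j = 0 yields \<open>X $ x\<close>;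
  the others are shifted by one, hence change sign, and reassemble by \<open>lin_Cons_index\<close>
  and induction.\<close>

lemma interior_emono: "xs \<noteq> [] \<Longrightarrow> interior X (emono xs) vs = lin (contr X xs) vs"
proof (induction xs arbitrary: vs)
  case (Cons x xs)
  show ?case
  proof (cases xs)
    case Nil
    then show ?thesis by (simp add: interior_eq emono_Cons)
  next
    case (Cons y ys)
    let ?n = "length ys"
    have n: "length xs = Suc ?n" using Cons by simp
    have IH: "emono xs (case_nat X us) = lin (contr X xs) us" for us
      using Cons.IH[of us] Cons by (simp add: interior_eq)
    have len: "\<forall>p\<in>set (contr X xs). length (snd p) = ?n" using length_contr[of X xs] n by auto
    have "interior X (emono (x # xs)) vs
      = X $ x * emono xs vs - (\<Sum>j\<le>?n. (-1) ^ j * vs j $ x * lin (contr X xs) (skip j vs))"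
      unfolding interior_eq emono_Cons n sum.atMost_Suc_shift by (simp add: IH sum_negf)
    then show ?thesis
      by (simp add: lin_Cons_index[OF len] lin_uminus)
  qed
qed simp

lemma skip_skip: "i \<le> j \<Longrightarrow> skip j (skip i vs) = skip i (skip (Suc j) vs)"
  by (auto simp: skip_def fun_eq_iff)

text \<open>Laplace expansion along the first two rows, collected into 2 x 2 minors. The double sum
  over i < j with both slots deleted has the shape of the Chevalley-Eilenberg formula in
  \<open>dext\<close>.\<close>

lemma emono_Cons_Cons:
  assumes n: "length ys = n"
  shows "emono (a # b # ys) vs = (\<Sum>i\<le>Suc n. \<Sum>j\<in>{i<..Suc n}. (-1) ^ (i + j + 1) *
    (vs i $ a * vs j $ b - vs j $ a * vs i $ b) * emono ys (skip i (skip j vs)))"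
proof -
  let ?D = "\<lambda>i j. emono ys (skip i (skip j vs))"
  have restrict: "{p \<in> {..Suc n}. q < p} = {q<..Suc n}" for q by auto
  have inner: "(-1) ^ p * vs p $ a * emono (b # ys) (skip p vs)
      = (\<Sum>q\<in>{q \<in> {..Suc n}. q < p}. (-1) ^ (p + q) * vs p $ a * vs q $ b * ?D q p)
      - (\<Sum>q\<in>{p<..Suc n}. (-1) ^ (p + q) * vs p $ a * vs q $ b * ?D p q)"
    if p: "p \<le> Suc n" for p
  proof -
    let ?h = "\<lambda>q. (-1) ^ (p + q) * vs p $ a * skip p vs q $ b * emono ys (skip q (skip p vs))"
    have "(-1) ^ p * vs p $ a * emono (b # ys) (skip p vs) = (\<Sum>q\<le>n. ?h q)"
      by (simp add: emono_Cons n sum_distrib_left power_add mult_ac)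
    \<comment> \<open>After slot p is deleted, positions below p keep their original index, while
      positions from p on stand for the original index plus one. The second range therefore gains a
      sign.\<close>
    also have "{..n} = {q \<in> {..Suc n}. q < p} \<union> {p..n}" using p by auto
    also have "(\<Sum>q\<in>{q \<in> {..Suc n}. q < p} \<union> {p..n}. ?h q)
        = (\<Sum>q\<in>{q \<in> {..Suc n}. q < p}. ?h q) + (\<Sum>q\<in>{p..n}. ?h q)"
      by (rule sum.union_disjoint) auto
    also have "(\<Sum>q\<in>{q \<in> {..Suc n}. q < p}. ?h q)
        = (\<Sum>q\<in>{q \<in> {..Suc n}. q < p}. (-1) ^ (p + q) * vs p $ a * vs q $ b * ?D q p)"
      by (intro sum.cong) (auto simp: skip_def)
    also have "(\<Sum>q\<in>{p..n}. ?h q)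
        = (\<Sum>q\<in>{p..n}. - ((-1) ^ (p + Suc q) * vs p $ a * vs (Suc q) $ b * ?D p (Suc q)))"
    proof (intro sum.cong refl)
      fix q assume "q \<in> {p..n}"
      then have "skip p vs q = vs (Suc q)" "skip q (skip p vs) = skip p (skip (Suc q) vs)"
        by (auto simp: skip_skip) (simp add: skip_def)
      then show "?h q = - ((-1) ^ (p + Suc q) * vs p $ a * vs (Suc q) $ b * ?D p (Suc q))"
        by simp
    qed
    also have "\<dots> = - (\<Sum>q\<in>Suc ` {p..n}. (-1) ^ (p + q) * vs p $ a * vs q $ b * ?D p q)"
      by (subst sum.reindex) (auto simp: sum_negf)
    also have "Suc ` {p..n} = {p<..Suc n}"
      by (auto simp: image_Suc_atLeastAtMost)
    finally show ?thesis by simp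
  qed
  have "emono (a # b # ys) vs
    = (\<Sum>p\<le>Suc n. \<Sum>q\<in>{q \<in> {..Suc n}. q < p}. (-1) ^ (p + q) * vs p $ a * vs q $ b * ?D q p)
      - (\<Sum>p\<le>Suc n. \<Sum>q\<in>{p<..Suc n}. (-1) ^ (p + q) * vs p $ a * vs q $ b * ?D p q)"
    unfolding emono_Cons[of a] using n by (simp add: inner sum_subtractf del: sum.atMost_Suc)
  \<comment> \<open>Exchanging the summations puts both triangular sums over pairs with the first
    index smaller, so that they pair off into minors.\<close>
  also have "(\<Sum>p\<le>Suc n. \<Sum>q\<in>{q \<in> {..Suc n}. q < p}. (-1) ^ (p + q) * vs p $ a * vs q $ b * ?D q p)
    = (\<Sum>q\<le>Suc n. \<Sum>p\<in>{p \<in> {..Suc n}. q < p}. (-1) ^ (p + q) * vs p $ a * vs q $ b * ?D q p)"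
    by (rule sum.swap_restrict) auto
  finally have "emono (a # b # ys) vs
    = (\<Sum>q\<le>Suc n. \<Sum>p\<in>{q<..Suc n}. (-1) ^ (p + q) * vs p $ a * vs q $ b * ?D q p)
      - (\<Sum>p\<le>Suc n. \<Sum>q\<in>{p<..Suc n}. (-1) ^ (p + q) * vs p $ a * vs q $ b * ?D p q)"
    unfolding restrict .
  then show ?thesis
    unfolding sum_subtractf[symmetric]
    by (simp only:) (intro sum.cong refl, simp add: algebra_simps)
qed

lemma lin_Cons_Cons_index:
  "\<forall>p\<in>set L. length (snd p) = n \<Longrightarrow>
   lin (map (\<lambda>(c, ys). (c, a # b # ys)) L) vs = (\<Sum>i\<le>Suc n. \<Sum>j\<in>{i<..Suc n}. (-1) ^ (i + j + 1) *
    (vs i $ a * vs j $ b - vs j $ a * vs i $ b) * lin L (skip i (skip j vs)))"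
proof (induction L)
  case (Cons p L)
  obtain c ys where p: "p = (c, ys)" by force
  have n: "length ys = n" and L: "\<forall>p\<in>set L. length (snd p) = n" using Cons.prems p by auto
  have "lin (map (\<lambda>(c, ys). (c, a # b # ys)) (p # L)) vs
    = c * emono (a # b # ys) vs + lin (map (\<lambda>(c, ys). (c, a # b # ys)) L) vs"
    by (simp add: p)
  then show ?case
    unfolding Cons.IH[OF L] emono_Cons_Cons[OF n] p sum_distrib_left sum.distrib[symmetric]
    by (simp only: lin_Cons) (intro sum.cong refl, simp add: algebra_simps)
qed simp

lemma br_eq: "br X Y = - (X $ 1 * Y $ 2 - Y $ 1 * X $ 2) *\<^sub>R bv 5 - (X $ 1 * Y $ 3 - Y $ 1 * X $ 3) *\<^sub>R bv 6"
  by (simp add: Finite_Cartesian_Product.vec_eq_iff br_def dE_def e2_eq_emono emono_2 bv_def axis_def)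

lemma interior_linear:
  assumes w: "is_form (Suc n) w"
  shows "linear (\<lambda>X. interior X w vs)"
proof -
  have "(case_nat 0 vs)(0 := X) = case_nat X vs" for X
    by (auto simp: fun_eq_iff split: nat.splits)
  then show ?thesis
    using is_form_linear[OF w zero_less_Suc, of "case_nat 0 vs"] by (simp add: interior_eq)
qed

text \<open>The Chevalley--Eilenberg formula amounts to
  \<open>dw = de\<^sup>5 \<and> \<iota>\<^bsub>e\<^sub>5\<^esub> w + de\<^sup>6 \<and> \<iota>\<^bsub>e\<^sub>6\<^esub> w\<close>.\<close>
lemma dext_emono:
  assumes "length xs = k" and ne: "xs \<noteq> []"
  shows "dext k (emono xs) vs = lin (map (\<lambda>(c, ys). (c, 1 # 2 # ys)) (contr (bv 5) xs) @
    map (\<lambda>(c, ys). (c, 1 # 3 # ys)) (contr (bv 6) xs)) vs"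
proof -
  obtain n where n: "length xs = Suc n" and k: "k = Suc n"
    using assms by (cases xs) auto
  have len: "\<forall>p\<in>set (contr X xs). length (snd p) = n" for X
    using length_contr[of X xs] n by auto
  have lin: "linear (\<lambda>X. interior X (emono xs) us)" for us
    using is_form_emono[of xs] n by (intro interior_linear) simp
  \<comment> \<open>The bracket occupies slot 0, so the term is a contraction, linear in the
    bracket, and the bracket lies in the span of e_5 and e_6. The minus signs of
    \<open>br_eq\<close> match the extra factor -1 in \<open>lin_Cons_Cons_index\<close>.\<close>
  have br: "emono xs (case_nat (br X Y) us) = - (X $ 1 * Y $ 2 - Y $ 1 * X $ 2) * lin (contr (bv 5) xs) us
      - (X $ 1 * Y $ 3 - Y $ 1 * X $ 3) * lin (contr (bv 6) xs) us" for X Y us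
    unfolding interior_eq[symmetric] br_eq linear_diff[OF lin] linear_cmul[OF lin]
    by (simp add: interior_emono[OF ne])
  show ?thesis
    unfolding k dext_def br lin_append lin_Cons_Cons_index[OF len] sum.distrib[symmetric]
    by (intro sum.cong refl) (simp add: algebra_simps)
qed

lemma dext_lin: "dext k (lin L) vs = (\<Sum>(c, xs)\<leftarrow>L. c * dext k (emono xs) vs)"
  by (induction L) (auto simp: dext_def sum_distrib_left sum.distrib algebra_simps)

section \<open>The Hodge star of a diagonal metric\<close>

text \<open>Indexing by a list allows arguments about distinctness and multisets of indices. Entries
  beyond the length are unspecified, but a k-form reads only its first k arguments.\<close>

definition unit_tuple :: "7 list \<Rightarrow> nat \<Rightarrow> real^7" where
  "unit_tuple xs = (\<lambda>r. bv (xs ! r))"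

lemma bv_nth: "bv i $ j = (if i = j then 1 else 0)"
  by (auto simp: bv_def axis_def)

lemma emono_unit_tuple_self: "distinct xs \<Longrightarrow> emono xs (unit_tuple xs) = 1"
proof -
  assume "distinct xs"
  then have "Matrix.mat (length xs) (length xs) (\<lambda>(i, j). unit_tuple xs j $ (xs ! i)) = 1\<^sub>m (length xs)"
    by (intro eq_matI) (auto simp: unit_tuple_def bv_nth nth_eq_iff_index_eq)
  then show ?thesis by (simp add: emono_eq_det)
qed

lemma emono_unit_tuple_commute:
  assumes "length xs = length ys"
  shows "emono xs (unit_tuple ys) = emono ys (unit_tuple xs)"
proof -
  let ?n = "length xs"
  let ?A = "Matrix.mat ?n ?n (\<lambda>(i, j). unit_tuple ys j $ (xs ! i))"
  have "Matrix.mat ?n ?n (\<lambda>(i, j). unit_tuple xs j $ (ys ! i)) = Matrix.transpose_mat ?A"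
    by (intro eq_matI) (auto simp: unit_tuple_def bv_nth)
  then show ?thesis
    using assms Determinant.det_transpose[of ?A ?n] by (simp add: emono_eq_det)
qed

text \<open>A repeated index in \<open>ys\<close> gives two equal columns, and an index outside
  \<open>xs\<close> gives a zero column. With both excluded, equal lengths force the same index
  set.\<close>

lemma emono_unit_tuple_nonzero:
  assumes xs: "distinct xs" and len: "length ys = length xs" and nz: "emono xs (unit_tuple ys) \<noteq> 0"
  shows "mset ys = mset xs"
proof -
  have "distinct ys"
  proof (rule ccontr)
    assume "\<not> distinct ys"
    then show False using nz by (simp add: emono_unit_tuple_commute[OF len[symmetric]] emono_not_distinct)
  qed
  moreover have "set ys \<subseteq> set xs"
  proof
    fix y assume "y \<in> set ys"
    then obtain r where r: "r < length xs" "ys ! r = y" using len by (auto simp: in_set_conv_nth)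
    show "y \<in> set xs"
    proof (rule ccontr)
      assume y: "y \<notin> set xs"
      have "(\<Prod>i<length xs. unit_tuple ys (\<sigma> i) $ (xs ! i)) = 0" if \<sigma>: "\<sigma> permutes {..<length xs}" for \<sigma>
      proof -
        obtain i where "i < length xs" "\<sigma> i = r"
          using permutes_image[OF \<sigma>] r(1) by (metis imageE lessThan_iff)
        moreover from this have "unit_tuple ys (\<sigma> i) $ (xs ! i) = 0"
          using y r by (auto simp: unit_tuple_def bv_nth)
        ultimately show ?thesis by (intro prod_zero) auto
      qed
      then have "emono xs (unit_tuple ys) = 0" unfolding emono_def by (intro sum.neutral) simp
      then show False using nz by simp
    qed
  qed
  ultimately have "set ys = set xs"
    using xs len by (intro card_subset_eq) (auto simp: distinct_card)
  then show ?thesis using xs \<open>distinct ys\<close> by (simp add: set_eq_iff_mset_eq_distinct)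
qed

section \<open>Top-degree pairings of complementary monomials\<close>

lemma wedge_scale_left: "wedge k l (\<lambda>vs. c * a vs) b vs = c * wedge k l a b vs"
  using wedge_linear_left[of "{()}" k l "\<lambda>_. c" "\<lambda>_. a" b vs] by simp

lemma wedge_scale_right: "wedge k l a (\<lambda>vs. c * b vs) vs = c * wedge k l a b vs"
  using wedge_linear_right[of "{()}" k l a "\<lambda>_. c" "\<lambda>_. b" vs] by simp

lemma emono_permute_list_middle:
  assumes p: "p permutes {..<length xs}"
  shows "emono (as @ permute_list p xs @ bs) vs = of_int (sign p) * emono (as @ xs @ bs) vs"
proof -
  have perm: "emono (permute_list p xs) = (\<lambda>vs. of_int (sign p) * emono xs vs)"
    using emono_permute_list[OF p] by (rule ext)
  have 1: "emono (permute_list p xs @ bs) = (\<lambda>vs. of_int (sign p) * emono (xs @ bs) vs)"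
    using wedge_emono[of "permute_list p xs" bs, symmetric]
    by (simp add: perm wedge_scale_left wedge_emono fun_eq_iff)
  have "emono (as @ permute_list p xs @ bs)
      = wedge (length as) (length (xs @ bs)) (emono as) (emono (permute_list p xs @ bs))"
    using wedge_emono[of as "permute_list p xs @ bs"] by simp
  then show ?thesis
    unfolding 1 by (simp only: wedge_scale_right wedge_emono)
qed

lemma distinct_length_7: "distinct xs \<Longrightarrow> length xs = 7 \<Longrightarrow> set xs = (UNIV :: 7 set)"
  by (intro card_subset_eq) (auto simp: distinct_card)

text \<open>If \<open>ys\<close> rearranges \<open>xs\<close>, both sides carry the sign of the
  permutation. Otherwise both vanish: seven distinct indices exhaust the type, so \<open>ys\<close>
  could not avoid \<open>as\<close> and \<open>bs\<close> without having the index set of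
  \<open>xs\<close>.\<close>

lemma emono_exchange:
  assumes dist: "distinct (as @ xs @ bs)" and l7: "length (as @ xs @ bs) = 7" and len: "length ys = length xs"
  shows "emono (as @ ys @ bs) vs = emono xs (unit_tuple ys) * emono (as @ xs @ bs) vs"
proof (cases "mset ys = mset xs")
  case True
  then obtain p where p: "p permutes {..<length xs}" "permute_list p xs = ys"
    by (rule mset_eq_permutation)
  have "emono xs (unit_tuple ys) = emono xs (unit_tuple xs \<circ> p)"
    using p by (intro emono_cong) (auto simp: unit_tuple_def permute_list_nth)
  also have "\<dots> = of_int (sign p)"
    using is_form_permute[OF is_form_emono p(1)] emono_unit_tuple_self[of xs] dist by simp
  finally show ?thesis using emono_permute_list_middle[OF p(1)] p(2) by simp
next
  case False
  then have 0: "emono xs (unit_tuple ys) = 0"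
    using emono_unit_tuple_nonzero[OF _ len] dist by auto
  have "\<not> distinct (as @ ys @ bs)"
  proof
    assume d: "distinct (as @ ys @ bs)"
    then have "set (as @ ys @ bs) = set (as @ xs @ bs)"
      using distinct_length_7[OF d] distinct_length_7[OF dist l7] len l7 by simp
    then have "set ys = set xs" using d dist by auto
    then show False using False d dist by (simp add: set_eq_iff_mset_eq_distinct)
  qed
  from emono_not_distinct[OF this] show ?thesis using 0 by simp
qed

text \<open>In the monomial expansion of \<open>a\<close> only rearrangements of \<open>xs\<close>
  survive the wedge. The coefficient obtained is the Euclidean inner product of \<open>a\<close>
  with \<open>emono xs\<close>.\<close>

lemma wedge_form_emono:
  assumes dist: "distinct (xs @ ys)" and l7: "length (xs @ ys) = 7" and a: "is_form (length xs) a"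
  shows "wedge (length xs) (length ys) a (emono ys) vs
    = (\<Sum>I\<in>PiE {..<length xs} (\<lambda>_. UNIV). a (\<lambda>r. bv (I r)) * emono xs (\<lambda>r. bv (I r)))
      / fact (length xs) * emono (xs @ ys) vs"
proof -
  let ?k = "length xs" and ?P = "PiE {..<length xs} (\<lambda>_. UNIV :: 7 set)"
  have fin: "finite ?P" by (intro finite_PiE) auto
  have "wedge ?k (length ys) a (emono ys) vs
    = wedge ?k (length ys) (\<lambda>vs. \<Sum>I\<in>?P. a (\<lambda>r. bv (I r)) / fact ?k * emono (map I [0..<?k]) vs) (emono ys) vs"
    using is_form_eq_sum_emono[OF a] by (intro arg_cong[where f = "\<lambda>a. wedge _ _ a _ _"] ext)
  also have "\<dots> = (\<Sum>I\<in>?P. a (\<lambda>r. bv (I r)) / fact ?k * emono (map I [0..<?k] @ ys) vs)"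
    unfolding wedge_linear_left[OF fin] by (simp flip: wedge_emono)
  also have "\<dots> = (\<Sum>I\<in>?P. a (\<lambda>r. bv (I r)) / fact ?k * (emono xs (\<lambda>r. bv (I r)) * emono (xs @ ys) vs))"
  proof (intro sum.cong refl arg_cong2[where f = "(*)"])
    fix I
    have "emono xs (unit_tuple (map I [0..<?k])) = emono xs (\<lambda>r. bv (I r))"
      by (rule emono_cong) (simp add: unit_tuple_def)
    then show "emono (map I [0..<?k] @ ys) vs = emono xs (\<lambda>r. bv (I r)) * emono (xs @ ys) vs"
      using emono_exchange[of "[]" xs ys "map I [0..<?k]"] dist l7 by simp
  qed
  finally show ?thesis by (simp add: sum_distrib_left sum_divide_distrib mult_ac)
qed

text \<open>Wedging with the complementary monomial isolates a single component of \<open>a\<close>;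
  this is what makes the pairing nondegenerate.\<close>

lemma wedge_emono_form:
  assumes dist: "distinct (xs @ ys)" and l7: "length (xs @ ys) = 7" and a: "is_form (length ys) a"
  shows "wedge (length xs) (length ys) (emono xs) a vs = a (unit_tuple ys) * emono (xs @ ys) vs"
proof -
  let ?k = "length ys" and ?P = "PiE {..<length ys} (\<lambda>_. UNIV :: 7 set)"
  have fin: "finite ?P" by (intro finite_PiE) auto
  have "wedge (length xs) ?k (emono xs) a vs
    = wedge (length xs) ?k (emono xs) (\<lambda>vs. \<Sum>I\<in>?P. a (\<lambda>r. bv (I r)) / fact ?k * emono (map I [0..<?k]) vs) vs"
    using is_form_eq_sum_emono[OF a] by (intro arg_cong[where f = "\<lambda>a. wedge _ _ _ a _"] ext)
  also have "\<dots> = (\<Sum>I\<in>?P. a (\<lambda>r. bv (I r)) / fact ?k * emono (xs @ map I [0..<?k]) vs)"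
    unfolding wedge_linear_right[OF fin] by (simp flip: wedge_emono)
  also have "\<dots> = (\<Sum>I\<in>?P. a (\<lambda>r. bv (I r)) / fact ?k * (emono (map I [0..<?k]) (unit_tuple ys) * emono (xs @ ys) vs))"
  proof (intro sum.cong refl arg_cong2[where f = "(*)"])
    fix I
    show "emono (xs @ map I [0..<?k]) vs = emono (map I [0..<?k]) (unit_tuple ys) * emono (xs @ ys) vs"
      using emono_exchange[of xs ys "[]" "map I [0..<?k]"] emono_unit_tuple_commute[of "map I [0..<?k]" ys] dist l7
      by simp
  qed
  also have "\<dots> = (\<Sum>I\<in>?P. a (\<lambda>r. bv (I r)) / fact ?k * emono (map I [0..<?k]) (unit_tuple ys)) * emono (xs @ ys) vs"
    by (simp add: sum_distrib_left mult_ac)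
  finally show ?thesis unfolding is_form_eq_sum_emono[OF a, of "unit_tuple ys"] .
qed

text \<open>Each component on distinct indices is tested against the monomial of the complementary
  indices; on repeated indices both forms vanish. This gives uniqueness in the definition of
  \<open>hodge\<close>.\<close>

lemma wedge_nondegenerate:
  assumes kl: "k + l = 7" and h: "is_form l h" and h': "is_form l h'"
    and eq: "\<And>a vs. is_form k a \<Longrightarrow> wedge k l a h vs = wedge k l a h' vs"
  shows "h = h'"
proof (rule is_form_eqI[OF h h'])
  fix I :: "nat \<Rightarrow> 7"
  let ?ys = "map I [0..<l]"
  have ys: "w (unit_tuple ?ys) = w (\<lambda>r. bv (I r))" if "is_form l w" for w
    by (rule is_form_cong[OF that]) (simp add: unit_tuple_def)
  show "h (\<lambda>r. bv (I r)) = h' (\<lambda>r. bv (I r))"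
  proof (cases "distinct ?ys")
    case True
    obtain xs where xs: "set xs = - set ?ys" "distinct xs"
      using finite_distinct_list[of "- set ?ys"] by auto
    have dist: "distinct (xs @ ?ys)" using xs True by auto
    have "card (set (xs @ ?ys)) = 7" using xs by (simp add: Un_commute Compl_partition)
    then have l7: "length (xs @ ?ys) = 7" using dist by (simp only: distinct_card)
    then have k: "length xs = k" using kl by simp
    have "wedge k l (emono xs) w (unit_tuple (xs @ ?ys)) = w (\<lambda>r. bv (I r))" if "is_form l w" for w
      using wedge_emono_form[OF dist l7, of w] that k emono_unit_tuple_self[OF dist] ys[OF that] by simp
    from this[OF h] this[OF h'] show ?thesis
      using eq[of "emono xs" "unit_tuple (xs @ ?ys)"] is_form_emono[of xs] k by simp
  next
    case False
    then obtain i j where "i < l" "j < l" "i \<noteq> j" "I i = I j" by (auto simp: distinct_conv_nth)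
    then show ?thesis using is_form_alternating[OF h, of i j] is_form_alternating[OF h', of i j] by simp
  qed
qed

lemma hodge_eqI:
  assumes "k \<le> 7" "is_form (7 - k) h"
    and "\<And>a vs. is_form k a \<Longrightarrow> wedge k (7 - k) a h vs = form_inner g k a b * volume g \<epsilon> vs"
  shows "hodge g \<epsilon> k b = h"
  unfolding hodge_def
proof (rule the_equality)
  fix h' assume "is_form (7 - k) h' \<and> (\<forall>a. is_form k a \<longrightarrow>
      (\<forall>vs. wedge k (7 - k) a h' vs = form_inner g k a b * volume g \<epsilon> vs))"
  then show "h' = h" using assms by (intro wedge_nondegenerate[of k "7 - k"]) auto
qed (use assms in auto)

section \<open>Diagonal metrics and their inner products on forms\<close>

definition diagm :: "(7 \<Rightarrow> real) \<Rightarrow> real^7^7" where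
  "diagm d = (\<chi> i j. if i = j then d i else 0)"

lemma diagm_nth: "diagm d $ i $ j = (if i = j then d i else 0)"
  by (simp add: diagm_def)

lemma det_diagm: "det (diagm d) = prod d UNIV"
  unfolding diagm_def by (subst det_diagonal) auto

lemma diagm_mult: "diagm c ** diagm d = diagm (\<lambda>i. c i * d i)"
  by (auto simp: diagm_def matrix_matrix_mult_def Finite_Cartesian_Product.vec_eq_iff mult_delta_left)

lemma diagm_one: "diagm (\<lambda>_. 1) = Finite_Cartesian_Product.mat 1"
  by (simp add: diagm_def Finite_Cartesian_Product.mat_def)

lemma matrix_inv_diagm:
  assumes "\<And>i. d i \<noteq> 0"
  shows "matrix_inv (diagm d) = diagm (\<lambda>i. 1 / d i)"
proof -
  have inv: "diagm d ** diagm (\<lambda>i. 1 / d i) = Finite_Cartesian_Product.mat 1"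
    "diagm (\<lambda>i. 1 / d i) ** diagm d = Finite_Cartesian_Product.mat 1"
    by (simp_all add: diagm_mult assms diagm_one)
  then have "diagm d ** matrix_inv (diagm d) = Finite_Cartesian_Product.mat 1"
    unfolding matrix_inv_def by (metis (mono_tags, lifting) someI_ex)
  then have "diagm (\<lambda>i. 1 / d i) ** (diagm d ** matrix_inv (diagm d)) = diagm (\<lambda>i. 1 / d i)"
    by simp
  then show ?thesis using inv by (simp add: matrix_mul_assoc)
qed

lemma form_inner_diagm:
  assumes d: "\<And>i. d i \<noteq> 0"
  shows "form_inner (diagm d) k a b = (1 / fact k) * (\<Sum>I\<in>PiE {..<k} (\<lambda>_. UNIV).
    (\<Prod>r<k. 1 / d (I r)) * a (\<lambda>r. bv (I r)) * b (\<lambda>r. bv (I r)))"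
proof -
  let ?P = "PiE {..<k} (\<lambda>_. UNIV :: 7 set)"
  have fin: "finite ?P" by (intro finite_PiE) auto
  have "(\<Sum>J\<in>?P. (\<Prod>r<k. matrix_inv (diagm d) $ I r $ J r) * a (\<lambda>r. bv (I r)) * b (\<lambda>r. bv (J r)))
      = (\<Prod>r<k. 1 / d (I r)) * a (\<lambda>r. bv (I r)) * b (\<lambda>r. bv (I r))" if I: "I \<in> ?P" for I
  proof -
    have "(\<Prod>r<k. matrix_inv (diagm d) $ I r $ J r) = (if I = J then \<Prod>r<k. 1 / d (I r) else 0)"
      if J: "J \<in> ?P" for J
    proof (cases "I = J")
      case False
      then obtain r where "r < k" "I r \<noteq> J r" using PiE_ext[OF I J] by auto
      then have "\<exists>r\<in>{..<k}. matrix_inv (diagm d) $ I r $ J r = 0"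
        by (auto simp: matrix_inv_diagm[OF d] diagm_nth)
      then show ?thesis using False by (simp add: prod_zero)
    qed (simp add: matrix_inv_diagm[OF d] diagm_nth)
    then have "(\<Sum>J\<in>?P. (\<Prod>r<k. matrix_inv (diagm d) $ I r $ J r) * a (\<lambda>r. bv (I r)) * b (\<lambda>r. bv (J r)))
      = (\<Sum>J\<in>?P. if I = J then (\<Prod>r<k. 1 / d (I r)) * a (\<lambda>r. bv (I r)) * b (\<lambda>r. bv (I r)) else 0)"
      by (intro sum.cong) auto
    then show ?thesis using I fin by simp
  qed
  then show ?thesis unfolding form_inner_def by simp
qed

text \<open>Every nonzero term of the inner product has indices rearranging \<open>xs\<close>, so
  all carry the same weight 1 / \<open>prod_list (map d xs)\<close>. Multiplying it away leaves the
  Euclidean coefficient of \<open>wedge_form_emono\<close>.\<close>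

lemma wedge_form_emono_inner:
  assumes dist: "distinct (xs @ ys)" and l7: "length (xs @ ys) = 7" and a: "is_form (length xs) a"
    and d: "\<And>i. d i \<noteq> 0"
  shows "wedge (length xs) (length ys) a (emono ys) vs
    = form_inner (diagm d) (length xs) a (emono xs) * prod_list (map d xs) * emono (xs @ ys) vs"
proof -
  let ?k = "length xs"
  have cancel: "(\<Prod>r<?k. 1 / d (I r)) * emono xs (\<lambda>r. bv (I r)) * prod_list (map d xs) = emono xs (\<lambda>r. bv (I r))" for I
  proof (cases "emono xs (\<lambda>r. bv (I r)) = 0")
    case False
    have "emono xs (unit_tuple (map I [0..<?k])) = emono xs (\<lambda>r. bv (I r))"
      by (rule emono_cong) (simp add: unit_tuple_def)
    then have "mset (map I [0..<?k]) = mset xs"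
      using False dist by (intro emono_unit_tuple_nonzero) auto
    then have "prod_mset (image_mset d (mset (map I [0..<?k]))) = prod_mset (image_mset d (mset xs))"
      by (simp only:)
    then have "prod_list (map d xs) = prod_list (map (\<lambda>r. d (I r)) [0..<?k])"
      by (simp add: prod_mset_prod_list[symmetric] image_mset.compositionality comp_def)
    also have "\<dots> = (\<Prod>r<?k. d (I r))"
      by (simp add: prod.list_conv_set_nth atLeast0LessThan)
    finally show ?thesis using d by (simp add: prod_dividef)
  qed simp
  have "form_inner (diagm d) ?k a (emono xs) * prod_list (map d xs)
    = (\<Sum>I\<in>PiE {..<?k} (\<lambda>_. UNIV). a (\<lambda>r. bv (I r)) * ((\<Prod>r<?k. 1 / d (I r)) *
        emono xs (\<lambda>r. bv (I r)) * prod_list (map d xs)) / fact ?k)"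
    unfolding form_inner_diagm[OF d] sum_distrib_left sum_distrib_right
    by (intro sum.cong refl) simp
  then show ?thesis unfolding wedge_form_emono[OF dist l7 a] cancel sum_divide_distrib by simp
qed

section \<open>Algebra of formal combinations\<close>

lemma lin_Cons_eq: "lin (p # L) = (\<lambda>vs. fst p * emono (snd p) vs + lin L vs)"
  by (rule ext) simp

lemma lin_Nil_eq: "lin [] = (\<lambda>vs. 0)"
  by (rule ext) simp

lemma is_form_lin: "\<forall>p\<in>set L. length (snd p) = k \<Longrightarrow> is_form k (lin L)"
proof (induction L)
  case Nil
  then show ?case by (simp add: is_form_def lin_Nil_eq linear_iff)
next
  case (Cons p L)
  then have w: "is_form k (lin L)" and e: "is_form k (emono (snd p))"
    using is_form_emono[of "snd p"] by auto
  show ?case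
    unfolding is_form_def lin_Cons_eq
  proof (intro conjI allI impI)
    fix vs ws :: "nat \<Rightarrow> real^7" assume "\<forall>i<k. vs i = ws i"
    then show "fst p * emono (snd p) vs + lin L vs = fst p * emono (snd p) ws + lin L ws"
      using is_form_cong[OF w, of vs ws] is_form_cong[OF e, of vs ws] by simp
  next
    fix i and vs :: "nat \<Rightarrow> real^7" assume "i < k"
    from is_form_linear[OF w this, of vs] is_form_linear[OF e this, of vs]
    show "linear (\<lambda>v. fst p * emono (snd p) (vs(i := v)) + lin L (vs(i := v)))"
      by (simp add: linear_iff algebra_simps)
  next
    fix vs :: "nat \<Rightarrow> real^7" and i j assume "i < k \<and> j < k \<and> i \<noteq> j \<and> vs i = vs j"
    then show "fst p * emono (snd p) vs + lin L vs = 0"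
      using is_form_alternating[OF w, of i j vs] is_form_alternating[OF e, of i j vs] by simp
  qed
qed

lemma wedge_add_left: "wedge k l (\<lambda>vs. a vs + a' vs) b vs = wedge k l a b vs + wedge k l a' b vs"
  by (simp add: wedge_def sum.distrib algebra_simps add_divide_distrib)

lemma wedge_add_right: "wedge k l a (\<lambda>vs. b vs + b' vs) vs = wedge k l a b vs + wedge k l a b' vs"
  by (simp add: wedge_def sum.distrib algebra_simps add_divide_distrib)

lemma wedge_zero_left: "wedge k l (\<lambda>vs. 0) b vs = 0"
  by (simp add: wedge_def)

lemma wedge_zero_right: "wedge k l a (\<lambda>vs. 0) vs = 0"
  by (simp add: wedge_def)

lemma wedge_lin_left: "wedge k l (lin L) b vs = (\<Sum>(c, xs)\<leftarrow>L. c * wedge k l (emono xs) b vs)"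
  by (induction L) (simp_all add: lin_Nil_eq lin_Cons_eq wedge_zero_left wedge_add_left wedge_scale_left case_prod_beta)

lemma wedge_lin_right: "wedge k l a (lin L) vs = (\<Sum>(c, xs)\<leftarrow>L. c * wedge k l a (emono xs) vs)"
  by (induction L) (simp_all add: lin_Nil_eq lin_Cons_eq wedge_zero_right wedge_add_right wedge_scale_right case_prod_beta)

text \<open>Products whose factors share an index are zero and are dropped at once, which keeps
  triple products small enough for the simplifier.\<close>

definition lin_wedge :: "(real \<times> 7 list) list \<Rightarrow> (real \<times> 7 list) list \<Rightarrow> (real \<times> 7 list) list" where
  "lin_wedge L M = concat (map (\<lambda>(c, xs). concat (map (\<lambda>(d, ys).
     if list_all (\<lambda>y. y \<notin> set xs) ys then [(c * d, xs @ ys)] else []) M)) L)"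

lemma wedge_lin:
  assumes L: "\<forall>p\<in>set L. length (snd p) = k" and M: "\<forall>p\<in>set M. length (snd p) = l"
  shows "wedge k l (lin L) (lin M) = lin (lin_wedge L M)"
proof
  fix vs
  have 1: "c * wedge k l (emono xs) (lin M) vs = lin (concat (map (\<lambda>(d, ys).
     if list_all (\<lambda>y. y \<notin> set xs) ys then [(c * d, xs @ ys)] else []) M)) vs"
    if xs: "length xs = k" for c xs
    using M
  proof (induction M)
    case Nil
    show ?case unfolding wedge_lin_right by simp
  next
    case (Cons p M)
    have IH: "c * wedge k l (emono xs) (lin M) vs = lin (concat (map (\<lambda>(d, ys).
     if list_all (\<lambda>y. y \<notin> set xs) ys then [(c * d, xs @ ys)] else []) M)) vs"
      using Cons by simp
    have "wedge k l (emono xs) (emono (snd p)) = emono (xs @ snd p)"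
      using wedge_emono[of xs "snd p"] xs Cons.prems by simp
    moreover have "emono (xs @ snd p) vs = 0" if "\<not> list_all (\<lambda>y. y \<notin> set xs) (snd p)"
    proof -
      have "\<not> distinct (xs @ snd p)" using that by (auto simp: list_all_iff)
      from emono_not_distinct[OF this] show ?thesis by simp
    qed
    moreover have expand: "wedge k l (emono xs) (lin (p # M)) vs
        = fst p * wedge k l (emono xs) (emono (snd p)) vs + wedge k l (emono xs) (lin M) vs"
      unfolding wedge_lin_right by (simp add: case_prod_beta)
    ultimately show ?case
      unfolding expand using IH by (cases p) (auto simp: distrib_left mult.assoc)
  qed
  show "wedge k l (lin L) (lin M) vs = lin (lin_wedge L M) vs"
    unfolding wedge_lin_left using L
  proof (induction L)
    case (Cons p L)
    then show ?case using 1[of "snd p" "fst p"] by (simp add: lin_wedge_def case_prod_beta[of _ p])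
  qed (simp add: lin_wedge_def)
qed

text \<open>\<open>eps xs bs\<close> evaluates \<open>emono xs\<close> on the basis vectors indexed by \<open>bs\<close> by Laplace
  expansion, so that the simplifier never sees a sum over permutations.\<close>
fun epos :: "7 \<Rightarrow> 7 list \<Rightarrow> real" where
  "epos x [] = 0"
| "epos x (b # bs) = (if b = x then 1 else - epos x bs)"

fun eps :: "7 list \<Rightarrow> 7 list \<Rightarrow> real" where
  "eps [] bs = 1"
| "eps (x # xs) bs = epos x bs * eps xs (remove1 x bs)"

lemma epos_append: "x \<notin> set us \<Longrightarrow> epos x (us @ x # ws) = (-1) ^ length us"
  by (induction us) auto

lemma epos_notin: "x \<notin> set bs \<Longrightarrow> epos x bs = 0"
  by (induction bs) auto

text \<open>In the expansion along \<open>x\<close> only the column where \<open>x\<close> occurs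
  survives. Its sign is \<open>epos\<close>, and deleting that vector is \<open>remove1\<close> on
  the index list.\<close>

lemma emono_unit_tuple: "distinct bs \<Longrightarrow> length bs = length xs \<Longrightarrow> emono xs (unit_tuple bs) = eps xs bs"
proof (induction xs arbitrary: bs)
  case (Cons x xs)
  have nth: "unit_tuple bs j $ x = (if bs ! j = x then 1 else 0)" for j
    by (simp add: unit_tuple_def bv_nth)
  show ?case
  proof (cases "x \<in> set bs")
    case True
    then obtain us ws where bs: "bs = us @ x # ws" "x \<notin> set us" by (meson split_list_first)
    let ?j = "length us"
    have j: "?j \<le> length xs" using bs Cons.prems by simp
    have eq: "bs ! i = x \<longleftrightarrow> i = ?j" if "i \<le> length xs" for i
      using Cons.prems that bs nth_eq_iff_index_eq[of bs i ?j] by (auto simp: nth_append)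
    have "emono (x # xs) (unit_tuple bs)
      = (\<Sum>j\<le>length xs. if j = ?j then (-1) ^ ?j * emono xs (skip ?j (unit_tuple bs)) else 0)"
      unfolding emono_Cons by (intro sum.cong refl) (auto simp: nth eq)
    also have "\<dots> = (-1) ^ ?j * emono xs (skip ?j (unit_tuple bs))" using j by simp
    also have "emono xs (skip ?j (unit_tuple bs)) = emono xs (unit_tuple (remove1 x bs))"
      using bs by (intro emono_cong) (auto simp: skip_def unit_tuple_def nth_append remove1_append Suc_diff_le)
    also have "\<dots> = eps xs (remove1 x bs)"
      using Cons.prems True by (intro Cons.IH) (auto simp: length_remove1)
    finally show ?thesis using bs by (simp add: epos_append)
  next
    case False
    have "emono (x # xs) (unit_tuple bs) = 0"
      unfolding emono_Cons
    proof (intro sum.neutral ballI)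
      fix j assume "j \<in> {..length xs}"
      then have "bs ! j \<noteq> x" using False Cons.prems nth_mem[of j bs] by auto
      then show "(-1) ^ j * unit_tuple bs j $ x * emono xs (skip j (unit_tuple bs)) = 0" by (simp add: nth)
    qed
    then show ?thesis using False by (simp add: epos_notin)
  qed
qed simp

definition contr_lin :: "real^7 \<Rightarrow> (real \<times> 7 list) list \<Rightarrow> (real \<times> 7 list) list" where
  "contr_lin X L = concat (map (\<lambda>(c, xs). map (\<lambda>(d, ys). (c * d, ys)) (contr X xs)) L)"

lemma lin_scale: "lin (map (\<lambda>(d, ys). (c * d, ys)) L) vs = c * lin L vs"
  by (induction L) (auto simp: algebra_simps)

lemma interior_lin:
  "\<forall>p\<in>set L. snd p \<noteq> [] \<Longrightarrow> interior X (lin L) = lin (contr_lin X L)"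
proof
  fix vs assume "\<forall>p\<in>set L. snd p \<noteq> []"
  then show "interior X (lin L) vs = lin (contr_lin X L) vs"
  proof (induction L)
    case (Cons p L)
    then show ?case
      using interior_emono[of "snd p" X vs]
      by (auto simp: interior_eq contr_lin_def lin_scale case_prod_beta[of _ p])
  qed (simp add: interior_eq contr_lin_def)
qed

text \<open>Bilinearity reduces the metric to 49 numerical evaluations on basis vectors.\<close>

lemma Bphi_expand:
  assumes w: "is_form 3 w"
  shows "Bphi w X Y = (\<Sum>i\<in>UNIV. \<Sum>j\<in>UNIV. X $ i * Y $ j * Bphi w (bv i) (bv j))"
proof -
  have int: "interior X w = (\<lambda>vs. \<Sum>i\<in>UNIV. X $ i * interior (bv i) w vs)" for X
  proof
    fix vs
    have lin: "linear (\<lambda>X. interior X w vs)"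
      using w by (intro interior_linear[of 2]) (simp add: eval_nat_numeral)
    have "interior X w vs = interior (\<Sum>i\<in>UNIV. X $ i *\<^sub>R bv i) w vs"
      using basis_expansion[of X] by (simp add: bv_def scalar_mult_eq_scaleR)
    also have "\<dots> = (\<Sum>i\<in>UNIV. X $ i * interior (bv i) w vs)"
      using linear_sum[OF lin, of "\<lambda>i. X $ i *\<^sub>R bv i" UNIV] by (simp add: linear_cmul[OF lin])
    finally show "interior X w vs = (\<Sum>i\<in>UNIV. X $ i * interior (bv i) w vs)" .
  qed
  have w22: "wedge 2 2 (interior X w) (interior Y w)
    = (\<lambda>vs. \<Sum>i\<in>UNIV. X $ i * (\<Sum>j\<in>UNIV. Y $ j * wedge 2 2 (interior (bv i) w) (interior (bv j) w) vs))"
    unfolding int[of X] int[of Y] by (rule ext) (simp only: wedge_linear_left wedge_linear_right finite)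
  show ?thesis
    unfolding Bphi_def w22
    by (simp only: wedge_linear_left finite) (simp add: sum_distrib_left mult_ac)
qed

lemma form_inner_lin: "form_inner g k a (lin L) = (\<Sum>(c, xs)\<leftarrow>L. c * form_inner g k a (emono xs))"
  by (induction L) (simp_all add: form_inner_def lin_Nil_eq lin_Cons_eq case_prod_beta sum.distrib sum_distrib_left algebra_simps)

abbreviation idx7 :: "7 list" where "idx7 \<equiv> [1, 2, 3, 4, 5, 6, 7]"

lemma emono_eq_eps_volume:
  assumes "distinct xs" "length xs = 7"
  shows "emono xs vs = eps xs idx7 * e1234567 vs" and "eps xs idx7 * eps xs idx7 = 1"
proof -
  have d: "distinct idx7" by simp
  have e: "emono idx7 (unit_tuple xs) = eps xs idx7"
    using emono_unit_tuple[OF d, of xs] emono_unit_tuple_commute[of idx7 xs] assms by simp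
  have eq: "emono xs vs = eps xs idx7 * emono idx7 vs" for vs
    using emono_exchange[of "[]" idx7 "[]" xs vs] e assms by simp
  then show "emono xs vs = eps xs idx7 * e1234567 vs" by (simp add: e1234567_eq_emono)
  show "eps xs idx7 * eps xs idx7 = 1"
    using eq[of "unit_tuple xs"] e emono_unit_tuple_self[OF assms(1)] by simp
qed

text \<open>Each triple holds a coefficient, a monomial and its complement in any order;
  \<open>eps (xs @ ys) idx7\<close> corrects the orientation. In the check against an arbitrary
  \<open>a\<close> this sign appears twice and squares to 1.\<close>

lemma hodge_lin:
  fixes T :: "(real \<times> 7 list \<times> 7 list) list"
  assumes T: "\<forall>(c, xs, ys)\<in>set T. length xs = k \<and> distinct (xs @ ys) \<and> length (xs @ ys) = 7"
    and k: "k \<le> 7" and d: "\<And>i. d i \<noteq> 0"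
  shows "hodge (diagm d) \<epsilon> k (lin (map (\<lambda>(c, xs, ys). (c, xs)) T))
    = lin (map (\<lambda>(c, xs, ys). (c * eps (xs @ ys) idx7 * \<epsilon> * sqrt (prod d UNIV) / prod_list (map d xs), ys)) T)"
proof (rule hodge_eqI[OF k])
  show "is_form (7 - k) (lin (map (\<lambda>(c, xs, ys).
      (c * eps (xs @ ys) idx7 * \<epsilon> * sqrt (prod d UNIV) / prod_list (map d xs), ys)) T))"
    using T by (intro is_form_lin) auto
  fix a vs assume a: "is_form k a"
  have wedge_eq: "wedge k (7 - k) a (emono ys) vs
      = form_inner (diagm d) k a (emono xs) * prod_list (map d xs) * eps (xs @ ys) idx7 * e1234567 vs"
    if "(c, xs, ys) \<in> set T" for c xs ys
  proof -
    have xs: "length xs = k" "distinct (xs @ ys)" "length (xs @ ys) = 7" using T that by auto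
    then have "length ys = 7 - k" by simp
    then show ?thesis
      using wedge_form_emono_inner[OF xs(2,3), of a d] a d xs emono_eq_eps_volume(1)[OF xs(2,3)]
      by (simp add: mult_ac)
  qed
  have eq: "c * eps (xs @ ys) idx7 * \<epsilon> * sqrt (prod d UNIV) / prod_list (map d xs) * wedge k (7 - k) a (emono ys) vs
     = c * form_inner (diagm d) k a (emono xs) * (\<epsilon> * sqrt (prod d UNIV) * e1234567 vs)"
    if "(c, xs, ys) \<in> set T" for c xs ys
  proof -
    have "distinct (xs @ ys)" "length (xs @ ys) = 7" using T that by auto
    note e = emono_eq_eps_volume(2)[OF this]
    have p: "prod_list (map d xs) \<noteq> 0" using d by (auto simp: prod_list_zero_iff)
    have "c * eps (xs @ ys) idx7 * \<epsilon> * sqrt (prod d UNIV) / prod_list (map d xs) * wedge k (7 - k) a (emono ys) vs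
      = c * (eps (xs @ ys) idx7 * eps (xs @ ys) idx7) * form_inner (diagm d) k a (emono xs) * (\<epsilon> * sqrt (prod d UNIV) * e1234567 vs)"
      unfolding wedge_eq[OF that] using p by simp
    then show ?thesis by (simp only: e mult_1_right)
  qed
  show "wedge k (7 - k) a (lin (map (\<lambda>(c, xs, ys).
      (c * eps (xs @ ys) idx7 * \<epsilon> * sqrt (prod d UNIV) / prod_list (map d xs), ys)) T)) vs
    = form_inner (diagm d) k a (lin (map (\<lambda>(c, xs, ys). (c, xs)) T)) * volume (diagm d) \<epsilon> vs"
    unfolding wedge_lin_right form_inner_lin volume_def det_diagm sum_list_mult_const[symmetric] map_map
    using eq by (intro arg_cong[where f = sum_list] map_cong) auto
qed

section \<open>The metric and the Laplacian of the family\<close>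

definition phi_list :: "real \<Rightarrow> (real \<times> 7 list) list" where
  "phi_list c = [(1, [1, 4, 7]), (1, [2, 6, 7]), (1, [3, 5, 7]), (c, [1, 2, 3]),
     (1, [1, 5, 6]), (1, [2, 4, 5]), (-1, [3, 4, 6])]"

lemma phi2t_eq_lin: "phi2t t = lin (phi_list (f2 t ^ 3))"
  by (simp add: fun_eq_iff phi2t_def phi_list_def e3_eq_emono)

lemma is_form_phi: "is_form 3 (lin (phi_list c))"
  by (rule is_form_lin) (simp add: phi_list_def)

text \<open>The contractions computed in advance with zero terms removed: three monomials each, to
  bound the size of the later triple wedge.\<close>

definition interior_phi_list :: "real \<Rightarrow> 7 \<Rightarrow> (real \<times> 7 list) list" where
  "interior_phi_list c i =
    (if i = 1 then [(1, [4, 7]), (c, [2, 3]), (1, [5, 6])]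
     else if i = 2 then [(1, [6, 7]), (- c, [1, 3]), (1, [4, 5])]
     else if i = 3 then [(1, [5, 7]), (c, [1, 2]), (-1, [4, 6])]
     else if i = 4 then [(-1, [1, 7]), (-1, [2, 5]), (1, [3, 6])]
     else if i = 5 then [(-1, [3, 7]), (-1, [1, 6]), (1, [2, 4])]
     else if i = 6 then [(-1, [2, 7]), (1, [1, 5]), (-1, [3, 4])]
     else [(1, [1, 4]), (1, [2, 6]), (1, [3, 5])])"

lemma interior_phi: "interior (bv i) (lin (phi_list c)) = lin (interior_phi_list c i)"
proof -
  have "interior (bv i) (lin (phi_list c)) = lin (contr_lin (bv i) (phi_list c))"
    by (rule interior_lin) (simp add: phi_list_def)
  then show ?thesis
    using exhaust_7[of i]
    by (auto simp: phi_list_def contr_lin_def interior_phi_list_def bv_nth fun_eq_iff)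
qed

lemma length_lin_wedge:
  "\<forall>p\<in>set L. length (snd p) = k \<Longrightarrow> \<forall>p\<in>set M. length (snd p) = l \<Longrightarrow>
   \<forall>p\<in>set (lin_wedge L M). length (snd p) = k + l"
  by (fastforce simp: lin_wedge_def split: if_splits)

lemma lin_at_basis:
  "\<forall>p\<in>set L. length (snd p) = 7 \<Longrightarrow>
   lin L (\<lambda>i. bv (of_nat (Suc i))) = (\<Sum>(c, xs)\<leftarrow>L. c * eps xs idx7)"
proof (induction L)
  case (Cons p L)
  have "emono (snd p) (\<lambda>i. bv (of_nat (Suc i))) = emono (snd p) (unit_tuple idx7)"
  proof (rule emono_cong)
    fix i assume "i < length (snd p)"
    then have "i < 7" using Cons.prems by simp
    then have "i = 0 \<or> i = 1 \<or> i = 2 \<or> i = 3 \<or> i = 4 \<or> i = 5 \<or> i = 6" by arith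
    then show "bv (of_nat (Suc i)) = unit_tuple idx7 i" by (auto simp: unit_tuple_def)
  qed
  also have "\<dots> = eps (snd p) idx7" using Cons.prems by (intro emono_unit_tuple) auto
  finally show ?case using Cons by (simp add: case_prod_beta)
qed simp

lemma Bphi_lin:
  assumes "interior X (lin L) = lin M" "interior Y (lin L) = lin N"
    and L: "\<forall>p\<in>set L. length (snd p) = 3"
    and M: "\<forall>p\<in>set M. length (snd p) = 2" and N: "\<forall>p\<in>set N. length (snd p) = 2"
  shows "Bphi (lin L) X Y = (1 / 6) * (\<Sum>(c, xs)\<leftarrow>lin_wedge (lin_wedge M N) L. c * eps xs idx7)"
proof -
  have l4: "\<forall>p\<in>set (lin_wedge M N). length (snd p) = 4"
    using length_lin_wedge[OF M N] by simp
  show ?thesis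
    unfolding Bphi_def assms(1,2) wedge_lin[OF M N] wedge_lin[OF l4 L]
    using lin_at_basis[of "lin_wedge (lin_wedge M N) L"] length_lin_wedge[OF l4 L] by simp
qed

text \<open>On the diagonal the three contracted monomials combine into three pairs, each counted
  twice and completed by one monomial of the form; these six equal terms cancel 1/6. For i in {1, 2,
  3} each of them uses e^123 exactly once, hence the factor c.\<close>

lemma Bphi_phi:
  "Bphi (lin (phi_list c)) (bv i) (bv j) = (if i = j then if i \<in> {1, 2, 3} then c else 1 else 0)"
proof -
  have "Bphi (lin (phi_list c)) (bv i) (bv j) = (1 / 6) *
    (\<Sum>(c, xs)\<leftarrow>lin_wedge (lin_wedge (interior_phi_list c i) (interior_phi_list c j)) (phi_list c). c * eps xs idx7)"
    by (rule Bphi_lin[OF interior_phi interior_phi]) (simp_all add: phi_list_def interior_phi_list_def)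
  then show ?thesis
    using exhaust_7[of i] exhaust_7[of j]
    by (elim disjE; hypsubst) (simp_all add: phi_list_def lin_wedge_def interior_phi_list_def)
qed

section \<open>Metric and orientation induced by the form\<close>

lemma diagm_mult_vec: "(diagm d *v X) $ i = d i * X $ i"
  by (simp add: diagm_def matrix_vector_mult_def mult_delta_left)

lemma inner_diagm: "X \<bullet> (diagm d *v Y) = (\<Sum>i\<in>UNIV. d i * X $ i * Y $ i)"
  by (simp add: inner_vec_def diagm_mult_vec mult_ac)

lemma posdef_sym_diagm:
  assumes "\<And>i. d i > 0"
  shows "posdef_sym (diagm d)"
  unfolding posdef_sym_def
proof (intro conjI allI impI)
  show "transpose (diagm d) = diagm d"
    by (auto simp: diagm_def Finite_Cartesian_Product.transpose_def Finite_Cartesian_Product.vec_eq_iff)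
  fix X :: "real^7" assume "X \<noteq> 0"
  then obtain i where i: "X $ i \<noteq> 0" by (auto simp: Finite_Cartesian_Product.vec_eq_iff)
  have "0 < d i * (X $ i * X $ i)" using assms i by (auto simp: zero_less_mult_iff neq_iff)
  also have "\<dots> \<le> (\<Sum>i\<in>UNIV. d i * (X $ i * X $ i))"
    by (intro member_le_sum[where f = "\<lambda>i. d i * (X $ i * X $ i)"]) (simp_all add: less_imp_le[OF assms])
  finally show "X \<bullet> (diagm d *v X) > 0" by (simp add: inner_diagm mult.assoc)
qed

lemma posdef_sym_det_nonzero:
  assumes "posdef_sym g"
  shows "det g \<noteq> 0"
proof -
  have "x = 0" if "g *v x = 0" for x
    using assms that unfolding posdef_sym_def by (metis inner_zero_right less_irrefl)
  then have "invertible g" by (simp add: invertible_left_inverse matrix_left_invertible_ker)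
  then show ?thesis by (simp add: invertible_det_nz)
qed

lemma det_scaleR_7: "det (s *\<^sub>R (g :: real^7^7)) = s ^ 7 * det g"
proof -
  have "s *\<^sub>R g = (\<chi> i. s *s g $ i)"
    by (simp add: Finite_Cartesian_Product.vec_eq_iff)
  then show ?thesis using Determinants.det_rows_mul[of "\<lambda>_. s" "\<lambda>i. g $ i"] by simp
qed

lemma inner_matrix_bv: "bv i \<bullet> (g *v bv j) = (g :: real^7^7) $ i $ j"
  by (simp add: bv_def inner_axis' matrix_vector_mult_basis column_def)

text \<open>Two solutions \<open>g\<close>, \<open>g'\<close> are proportional, \<open>g' = s g\<close> with \<open>s > 0\<close>;
  comparing \<open>\<surd>(det g)\<close> and \<open>\<surd>(det g')\<close> gives \<open>s\<^sup>9 = 1\<close>.\<close>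
lemma metric_orient_unique:
  assumes g: "posdef_sym g" and g': "posdef_sym g'" and e: "\<epsilon> \<in> {-1, 1}"
    and eq: "\<And>X Y. (X \<bullet> (g' *v Y)) * (\<epsilon> * sqrt (det g')) = (X \<bullet> (g *v Y)) * sqrt (det g)"
  shows "g' = g" and "\<epsilon> = 1"
proof -
  define s where "s = sqrt (det g) / (\<epsilon> * sqrt (det g'))"
  have nz: "sqrt (det g) \<noteq> 0" "\<epsilon> * sqrt (det g') \<noteq> 0"
    using posdef_sym_det_nonzero[OF g] posdef_sym_det_nonzero[OF g'] e by auto
  have scale: "s * (\<epsilon> * sqrt (det g')) = sqrt (det g)" using nz by (simp add: s_def)
  have in': "X \<bullet> (g' *v Y) = s * (X \<bullet> (g *v Y))" for X Y
    using eq[of X Y] nz by (simp add: s_def field_simps)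
  have "bv 1 \<noteq> (0 :: real^7)" by (simp add: bv_def axis_eq_0_iff)
  then have "bv 1 \<bullet> (g *v bv 1) > 0" "bv 1 \<bullet> (g' *v bv 1) > 0"
    using g g' unfolding posdef_sym_def by blast+
  then have s: "s > 0" using in'[of "bv 1" "bv 1"] by (simp add: zero_less_mult_iff)
  have sg: "g' = s *\<^sub>R g"
    using in'[of "bv _" "bv _"] by (simp add: inner_matrix_bv Finite_Cartesian_Product.vec_eq_iff)
  then have "sqrt (det g') = sqrt (s ^ 7) * sqrt (det g)"
    by (simp add: det_scaleR_7 real_sqrt_mult)
  then have 1: "\<epsilon> * (s * sqrt (s ^ 7)) = 1"
    using nz scale by (simp add: mult_ac)
  have pos: "s * sqrt (s ^ 7) > 0" using s by simp
  \<comment> \<open>The product of \<epsilon> with a positive number is 1, which excludes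
    -1.\<close>
  show "\<epsilon> = 1"
    using e 1 pos by auto
  then have "(s * sqrt (s ^ 7)) ^ 2 = 1" using 1 by simp
  then have "s ^ 9 = 1 ^ 9"
    using s by (simp add: power_mult_distrib flip: power_add)
  then have "s = 1" using s by (intro power_eq_imp_eq_base[of s 9 1]) auto
  then show "g' = g" using sg by simp
qed

lemma metric_of_eqI:
  assumes g: "posdef_sym g" and eq: "\<And>X Y. (X \<bullet> (g *v Y)) * sqrt (det g) = Bphi w X Y"
  shows "metric_of w = g" and "orient_of w = 1"
proof -
  show m: "metric_of w = g"
    unfolding metric_of_def
  proof (rule the_equality)
    show "posdef_sym g \<and> (\<exists>\<epsilon>\<in>{-1, 1::real}. \<forall>X Y. (X \<bullet> (g *v Y)) * (\<epsilon> * sqrt (det g)) = Bphi w X Y)"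
      using assms by auto
    fix g' assume "posdef_sym g' \<and> (\<exists>\<epsilon>\<in>{-1, 1::real}. \<forall>X Y. (X \<bullet> (g' *v Y)) * (\<epsilon> * sqrt (det g')) = Bphi w X Y)"
    then obtain \<epsilon> :: real where "posdef_sym g'" "\<epsilon> \<in> {-1, 1}"
      "\<And>X Y. (X \<bullet> (g' *v Y)) * (\<epsilon> * sqrt (det g')) = Bphi w X Y" by blast
    then show "g' = g" using metric_orient_unique(1)[OF g, of g' \<epsilon>] eq by metis
  qed
  show "orient_of w = 1"
    unfolding orient_of_def m
  proof (rule the_equality)
    show "1 \<in> {-1, 1::real} \<and> (\<forall>X Y. (X \<bullet> (g *v Y)) * (1 * sqrt (det g)) = Bphi w X Y)"
      using eq by simp
    fix \<epsilon> :: real assume "\<epsilon> \<in> {-1, 1} \<and> (\<forall>X Y. (X \<bullet> (g *v Y)) * (\<epsilon> * sqrt (det g)) = Bphi w X Y)"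
    then show "\<epsilon> = 1" using metric_orient_unique(2)[OF g g, of \<epsilon>] eq by metis
  qed
qed

text \<open>The form \<open>Bphi\<close> has diagonal entries f^3 and 1 and must equal sqrt(det g)
  times g. These entries have determinant f^6 / f^4 = f^2, so sqrt(det g) = f, and multiplying by f
  restores f^3 and 1.\<close>

definition dphi :: "real \<Rightarrow> 7 \<Rightarrow> real" where
  "dphi f i = (if i \<in> {1, 2, 3} then f\<^sup>2 else 1 / f)"

lemma dphi_pos: "f > 0 \<Longrightarrow> dphi f i > 0"
  by (simp add: dphi_def)

lemma dphi_simps:
  "dphi f 1 = f\<^sup>2" "dphi f 2 = f\<^sup>2" "dphi f 3 = f\<^sup>2"
  "dphi f 4 = 1 / f" "dphi f 5 = 1 / f" "dphi f 6 = 1 / f" "dphi f 7 = 1 / f"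
  by (simp_all add: dphi_def)

lemma sqrt_prod_dphi:
  assumes "f > 0"
  shows "sqrt (prod (dphi f) UNIV) = f"
proof -
  have "prod (dphi f) UNIV = f\<^sup>2"
    using assms unfolding UNIV_7 by (simp add: dphi_def power2_eq_square)
  then show ?thesis using real_sqrt_abs[of f] assms by (simp only: abs_of_pos)
qed

lemma
  assumes f: "f > 0"
  shows metric_of_phi: "metric_of (lin (phi_list (f ^ 3))) = diagm (dphi f)"
    and orient_of_phi: "orient_of (lin (phi_list (f ^ 3))) = 1"
proof -
  have eq: "(X \<bullet> (diagm (dphi f) *v Y)) * sqrt (det (diagm (dphi f))) = Bphi (lin (phi_list (f ^ 3))) X Y" for X Y
  proof -
    define b :: "7 \<Rightarrow> real" where "b i = (if i \<in> {1, 2, 3} then f ^ 3 else 1)" for i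
    have b: "b i = dphi f i * f" for i
      using f by (simp add: b_def dphi_def power2_eq_square power3_eq_cube)
    have "Bphi (lin (phi_list (f ^ 3))) X Y
        = (\<Sum>i\<in>UNIV. \<Sum>j\<in>UNIV. if i = j then X $ i * Y $ j * b i else 0)"
      unfolding Bphi_expand[OF is_form_phi, of _ X Y] Bphi_phi b_def[symmetric] by (simp only: mult_delta_right)
    also have "\<dots> = (\<Sum>i\<in>UNIV. dphi f i * X $ i * Y $ i) * f"
      by (simp add: b sum_distrib_left mult_ac)
    finally show ?thesis by (simp add: inner_diagm det_diagm sqrt_prod_dphi[OF f])
  qed
  show "metric_of (lin (phi_list (f ^ 3))) = diagm (dphi f)" "orient_of (lin (phi_list (f ^ 3))) = 1"
    using metric_of_eqI[OF posdef_sym_diagm eq] dphi_pos[OF f] by auto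
qed

section \<open>Closedness and the Laplacian\<close>

lemma emono_swap: "emono (as @ y # x # bs) vs = - emono (as @ x # y # bs) vs"
proof -
  have p: "Transposition.transpose 0 1 permutes {..<length [x, y]}"
    by (rule permutes_swap_id) auto
  have "permute_list (Transposition.transpose 0 1) [x, y] = [y, x]"
    by (simp add: permute_list_def Transposition.transpose_def)
  then show ?thesis
    using emono_permute_list_middle[OF p, of as bs vs] by (simp add: sign_swap_id)
qed

text \<open>Repeated indices kill every term except those from e^267 and e^357, which produce e^1327
  and e^1237 with equal coefficients and cancel, whatever c is.\<close>

lemma dext_phi: "dext 3 (lin (phi_list c)) = (\<lambda>_. 0)"
proof
  fix vs
  show "dext 3 (lin (phi_list c)) vs = 0"
    unfolding dext_lin using emono_swap[of "[1]" 3 2 "[7]" vs]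
    by (simp add: phi_list_def dext_emono bv_nth emono_not_distinct)
qed

lemma hodge_phi:
  assumes f: "f > 0"
  shows "hodge (diagm (dphi f)) 1 3 (lin (phi_list (f ^ 3))) =
    lin [(f, [2, 3, 5, 6]), (- f, [1, 3, 4, 5]), (- f, [1, 2, 4, 6]), (1 / f\<^sup>2, [4, 5, 6, 7]),
      (f, [2, 3, 4, 7]), (- f, [1, 3, 6, 7]), (f, [1, 2, 5, 7])]"
proof -
  have d: "dphi f i \<noteq> 0" for i using dphi_pos[OF f, of i] by simp
  show ?thesis
    \<comment> \<open>Six monomials have one index in {1, 2, 3} and two outside: weight f / (f^2
      f^-2) = f. For e^123 the coefficient is f^3 f / f^6 = 1 / f^2.\<close>
    using hodge_lin[of "[(1, [1, 4, 7], [2, 3, 5, 6]), (1, [2, 6, 7], [1, 3, 4, 5]),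
        (1, [3, 5, 7], [1, 2, 4, 6]), (f ^ 3, [1, 2, 3], [4, 5, 6, 7]), (1, [1, 5, 6], [2, 3, 4, 7]),
        (1, [2, 4, 5], [1, 3, 6, 7]), (-1, [3, 4, 6], [1, 2, 5, 7])]" 3 "dphi f" 1, OF _ _ d] f
    by (simp add: sqrt_prod_dphi phi_list_def dphi_simps power2_eq_square power3_eq_cube)
qed

text \<open>Apart from e^4567, each monomial contains the index 1, or lacks both 5 and 6, or
  (e^2356) contains both 2 and 3; its derivative then has a repeated index or is zero
  outright.\<close>

lemma dext_hodge_phi:
  "dext 4 (lin [(f, [2, 3, 5, 6]), (- f, [1, 3, 4, 5]), (- f, [1, 2, 4, 6]), (1 / f\<^sup>2, [4, 5, 6, 7]),
      (f, [2, 3, 4, 7]), (- f, [1, 3, 6, 7]), (f, [1, 2, 5, 7])])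
   = lin [(- (1 / f\<^sup>2), [1, 2, 4, 6, 7]), (1 / f\<^sup>2, [1, 3, 4, 5, 7])]" (is "dext 4 (lin ?L) = _")
proof
  fix vs
  show "dext 4 (lin ?L) vs = lin [(- (1 / f\<^sup>2), [1, 2, 4, 6, 7]), (1 / f\<^sup>2, [1, 3, 4, 5, 7])] vs"
    unfolding dext_lin by (simp add: dext_emono bv_nth emono_not_distinct diff_divide_distrib)
qed

lemma hodge_dext_hodge_phi:
  assumes f: "f > 0"
  shows "hodge (diagm (dphi f)) 1 5 (lin [(- (1 / f\<^sup>2), [1, 2, 4, 6, 7]), (1 / f\<^sup>2, [1, 3, 4, 5, 7])])
    = lin [(1 / f\<^sup>2, [3, 5]), (- (1 / f\<^sup>2), [2, 6])]"
proof -
  have d: "dphi f i \<noteq> 0" for i using dphi_pos[OF f, of i] by simp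
  show ?thesis
    \<comment> \<open>Here the weight is f / (f^4 f^-3) = 1, so only signs change.\<close>
    using hodge_lin[of "[(- (1 / f\<^sup>2), [1, 2, 4, 6, 7], [3, 5]), (1 / f\<^sup>2, [1, 3, 4, 5, 7], [2, 6])]"
        5 "dphi f" 1, OF _ _ d] f
    by (simp add: sqrt_prod_dphi dphi_simps power2_eq_square)
qed

lemma dext_2_form:
  "dext 2 (lin [(c, [3, 5]), (- c, [2, 6])]) vs = - 2 * c * emono [1, 2, 3] vs"
  unfolding dext_lin using emono_swap[of "[1]" 3 2 "[]" vs]
  by (simp add: dext_emono bv_nth)

lemma laplacian_phi:
  assumes f: "f > 0"
  shows "laplacian (lin (phi_list (f ^ 3))) vs = 2 / f\<^sup>2 * emono [1, 2, 3] vs"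
  using dext_2_form[of "1 / f\<^sup>2" vs]
  by (simp add: laplacian_def Let_def metric_of_phi[OF f] orient_of_phi[OF f] hodge_phi[OF f]
      dext_hodge_phi hodge_dext_hodge_phi[OF f])

lemma emono_scale:
  assumes "\<And>i k. ws i $ k = c k * vs i $ m k"
  shows "emono xs ws = prod_list (map c xs) * emono (map m xs) vs"
  unfolding emono_def
  by (simp add: assms prod.distrib sum_distrib_left mult_ac prod.list_conv_set_nth atLeast0LessThan)

lemma is_G2_form_phi:
  assumes f: "f > 0"
  shows "is_G2_form (lin (phi_list (f ^ 3)))"
proof -
  \<comment> \<open>The adapted coframe is
    \<open>(f e\<^sup>1, f e\<^sup>2, r e\<^sup>4, - r e\<^sup>6, r e\<^sup>7, - r e\<^sup>5, f e\<^sup>3)\<close>.\<close>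
  define r where "r = 1 / sqrt f"
  have r: "r \<noteq> 0" "f * r * r = 1" using f by (auto simp: r_def)
  define c :: "7 \<Rightarrow> real" where "c k = (if k \<in> {1, 2, 7} then f else if k \<in> {4, 6} then - r else r)" for k
  define m :: "7 \<Rightarrow> 7" where "m k = (if k = 3 then 4 else if k = 4 then 6 else if k = 5 then 7
    else if k = 6 then 5 else if k = 7 then 3 else k)" for k
  define P :: "real^7^7" where "P = (\<chi> k j. if m k = j then c k else 0)"
  have Pv: "(P *v v) $ k = c k * v $ m k" for v k
    by (simp add: P_def matrix_vector_mult_def mult_delta_left)
  have "x = 0" if "P *v x = 0" for x
  proof -
    have "\<forall>k. c k * x $ m k = 0" using that Pv[of x] by simp
    then show ?thesis
      unfolding forall_7 Finite_Cartesian_Product.vec_eq_iff using f r(1) by (simp add: c_def m_def)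
  qed
  then have "invertible P" by (simp add: invertible_left_inverse matrix_left_invertible_ker)
  moreover have "lin (phi_list (f ^ 3)) vs = phi0 (\<lambda>i. P *v vs i)" for vs
  proof -
    have "emono xs (\<lambda>i. P *v vs i) = prod_list (map c xs) * emono (map m xs) vs" for xs
      by (rule emono_scale) (rule Pv)
    \<comment> \<open>The term 127 of \<open>phi0\<close> picks up f^3 and becomes e^123; each of
      the other six picks up one f and two factors r up to sign, and r was chosen so that f r^2 =
      1.\<close>
    moreover have "f * (r * r) = 1" "r * (f * r) = 1" "r * (r * f) = 1" "f * (f * f) = f ^ 3"
      using r by (simp_all add: mult_ac power3_eq_cube)
    ultimately show ?thesis
      unfolding phi0_def e3_eq_emono
      by (simp add: c_def m_def phi_list_def) (simp add: emono_Cons skip_def algebra_simps)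
  qed
  ultimately show ?thesis unfolding is_G2_form_def by blast
qed

section \<open>The scalar evolution equation\<close>

lemma f2_pos: "t > -3/10 \<Longrightarrow> f2 t > 0"
  by (simp add: f2_def)

lemma f2_cube_deriv:
  assumes t: "t > -3/10"
  shows "((\<lambda>s. f2 s ^ 3) has_real_derivative 2 / (f2 t)\<^sup>2) (at t)"
proof -
  let ?u = "10 / 3 * t + 1"
  have u: "?u > 0" using t by simp
  have "(f2 has_real_derivative (10/3) * (1/5 * ?u powr (1/5 - 1))) (at t)"
    unfolding f2_def[abs_def] using u
    by (auto intro!: derivative_eq_intros)
  then have "((\<lambda>s. f2 s ^ 3) has_real_derivative 3 * (f2 t)\<^sup>2 * ((10/3) * (1/5 * ?u powr (1/5 - 1)))) (at t)"
    by (auto intro!: derivative_eq_intros)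
  \<comment> \<open>The derivative of u^(1/5) contains u^(-4/5), which is f^-4; this turns 3 f^2 f'
    into 2 / f^2.\<close>
  moreover have "?u powr (1/5 - 1) * f2 t ^ 4 = 1"
  proof -
    have "f2 t ^ 4 = ?u powr (4/5)"
      using u by (simp add: f2_def powr_power)
    then have "?u powr (1/5 - 1) * f2 t ^ 4 = ?u powr ((1/5 - 1) + 4/5)"
      by (simp only: powr_add)
    then show ?thesis using u by simp
  qed
  then have "?u powr (1/5 - 1) = 1 / f2 t ^ 4"
    using f2_pos[OF t] by (simp add: eq_divide_eq)
  moreover have "3 * (f2 t)\<^sup>2 * ((10/3) * (1/5 * (1 / f2 t ^ 4))) = 2 / (f2 t)\<^sup>2"
    using f2_pos[OF t] by (simp add: divide_simps)
  ultimately show ?thesis by (simp only:)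
qed

lemma laplacian_flow_phi2t: "laplacian_flow_solution phi2t {-3/10<..} phi2"
  unfolding laplacian_flow_solution_def
proof (intro conjI ballI allI)
  show "phi2t 0 = phi2" by (simp add: phi2t_def phi2_def f2_def)
  fix t :: real assume "t \<in> {-3/10<..}"
  then have t: "t > -3/10" by simp
  note f = f2_pos[OF t]
  show "is_G2_form (phi2t t)" using is_G2_form_phi[OF f] by (simp add: phi2t_eq_lin)
  show "is_form 3 (phi2t t)" using is_form_phi by (simp add: phi2t_eq_lin)
  show "dext 3 (phi2t t) = (\<lambda>_. 0)" using dext_phi by (simp add: phi2t_eq_lin)
  fix vs
  show "((\<lambda>s. phi2t s vs) has_real_derivative laplacian (phi2t t) vs) (at t)"
  proof -
    \<comment> \<open>Only the e^123 coefficient depends on time, the direction of the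
      Laplacian.\<close>
    have split: "phi2t s vs = lin (phi_list 0) vs + f2 s ^ 3 * emono [1, 2, 3] vs" for s
      by (simp add: phi2t_eq_lin phi_list_def)
    have "((\<lambda>s. lin (phi_list 0) vs + f2 s ^ 3 * emono [1, 2, 3] vs) has_real_derivative
        0 + 2 / (f2 t)\<^sup>2 * emono [1, 2, 3] vs) (at t)"
      by (intro DERIV_add DERIV_const DERIV_cmult_right f2_cube_deriv[OF t])
    then show ?thesis
      unfolding split by (simp only: phi2t_eq_lin laplacian_phi[OF f] add_0)
  qed
qed simp

section \<open>Convergence to a flat metric\<close>

text \<open>A class closed under all \<open>pd\<close> that contains every entry of the rescaled
  metrics and every component of the scaling maps.\<close>

definition quad :: "7 \<Rightarrow> real \<Rightarrow> real \<Rightarrow> real \<Rightarrow> real^7 \<Rightarrow> real" where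
  "quad k a b c x = a + b * x $ k + c * (x $ k)\<^sup>2"

lemma quad_line_deriv:
  "((\<lambda>s. quad k a b c (x + s *\<^sub>R axis i 1)) has_real_derivative
     (if i = k then b + 2 * c * x $ k else 0)) (at 0)"
  unfolding quad_def axis_def by (auto intro!: derivative_eq_intros)

lemma pd_quad: "pd i (quad k a b c) = (if i = k then quad k b (2 * c) 0 else quad k 0 0 0)"
proof
  fix x
  show "pd i (quad k a b c) x = (if i = k then quad k b (2 * c) 0 else quad k 0 0 0) x"
    unfolding pd_def using DERIV_imp_deriv[OF quad_line_deriv[of k a b c x i]]
    by (simp add: quad_def)
qed

text \<open>Differentiation acts on the coefficients by (a, b, c) to (b, 2c, 0) or to zero, which is
  continuous, so coefficient limits pass to every iterated derivative. Constant families give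
  smoothness as well.\<close>

lemma iter_pd_quad:
  assumes "(a \<longlongrightarrow> a0) F" "(b \<longlongrightarrow> b0) F" "(c \<longlongrightarrow> c0) F"
  shows "\<exists>a' b' c' a0' b0' c0'. (a' \<longlongrightarrow> a0') F \<and> (b' \<longlongrightarrow> b0') F \<and> (c' \<longlongrightarrow> c0') F \<and>
    (\<forall>t. iter_pd is (quad k (a t) (b t) (c t)) = quad k (a' t) (b' t) (c' t)) \<and>
    iter_pd is (quad k a0 b0 c0) = quad k a0' b0' c0'"
proof (induction "is")
  case Nil
  show ?case
    by (rule exI[of _ a], rule exI[of _ b], rule exI[of _ c],
        rule exI[of _ a0], rule exI[of _ b0], rule exI[of _ c0]) (simp add: assms)
next
  case (Cons i "is")
  then obtain a' b' c' a0' b0' c0' where IH: "(a' \<longlongrightarrow> a0') F" "(b' \<longlongrightarrow> b0') F" "(c' \<longlongrightarrow> c0') F"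
    "\<And>t. iter_pd is (quad k (a t) (b t) (c t)) = quad k (a' t) (b' t) (c' t)"
    "iter_pd is (quad k a0 b0 c0) = quad k a0' b0' c0'" by blast
  show ?case
  proof (cases "i = k")
    case True
    have "((\<lambda>t. 2 * c' t) \<longlongrightarrow> 2 * c0') F" by (intro tendsto_intros IH)
    then show ?thesis
      using True IH
      by - (rule exI[of _ b'], rule exI[of _ "\<lambda>t. 2 * c' t"], rule exI[of _ "\<lambda>_. 0"],
        rule exI[of _ b0'], rule exI[of _ "2 * c0'"], rule exI[of _ 0], simp add: pd_quad)
  next
    case False
    then show ?thesis
      using IH
      by - (rule exI[of _ "\<lambda>_. 0"], rule exI[of _ "\<lambda>_. 0"], rule exI[of _ "\<lambda>_. 0"],
        rule exI[of _ 0], rule exI[of _ 0], rule exI[of _ 0], simp add: pd_quad)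
  qed
qed

lemma smooth_fun_quad: "smooth_fun (quad k a b c)"
  unfolding smooth_fun_def
proof (intro allI conjI)
  fix "is" and i x
  obtain a' b' c' where *: "iter_pd is (quad k a b c) = quad k a' b' c'"
    using iter_pd_quad[OF tendsto_const tendsto_const tendsto_const, where F = bot] by blast
  show "continuous_on UNIV (iter_pd is (quad k a b c))"
    unfolding * unfolding quad_def by (intro continuous_intros)
  show "(\<lambda>s. iter_pd is (quad k a b c) (x + s *\<^sub>R axis i 1)) differentiable (at 0)"
    unfolding * using quad_line_deriv[of k a' b' c' x i] real_differentiable_def by blast
qed

lemma uniform_limit_quad:
  assumes K: "compact K" and lim: "(a \<longlongrightarrow> a0) F" "(b \<longlongrightarrow> b0) F" "(c \<longlongrightarrow> c0) F"
  shows "uniform_limit K (\<lambda>t. quad k (a t) (b t) (c t)) (quad k a0 b0 c0) F"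
proof (rule uniform_limitI)
  fix e :: real assume e: "e > 0"
  obtain M where M: "\<And>x. x \<in> K \<Longrightarrow> norm x \<le> M" using compact_imp_bounded[OF K] by (auto simp: bounded_iff)
  let ?g = "\<lambda>t. \<bar>a t - a0\<bar> + \<bar>b t - b0\<bar> * \<bar>M\<bar> + \<bar>c t - c0\<bar> * \<bar>M\<bar>\<^sup>2"
  have "(?g \<longlongrightarrow> \<bar>a0 - a0\<bar> + \<bar>b0 - b0\<bar> * \<bar>M\<bar> + \<bar>c0 - c0\<bar> * \<bar>M\<bar>\<^sup>2) F"
    by (intro tendsto_intros lim)
  then have "eventually (\<lambda>t. ?g t < e) F" using e by (intro order_tendstoD(2)) auto
  then show "\<forall>\<^sub>F t in F. \<forall>x\<in>K. dist (quad k (a t) (b t) (c t) x) (quad k a0 b0 c0 x) < e"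
  proof eventually_elim
    case (elim t)
    show ?case
    proof
      fix x assume "x \<in> K"
      then have x: "\<bar>x $ k\<bar> \<le> \<bar>M\<bar>" using M[of x] component_le_norm_cart[of x k] by linarith
      have "quad k (a t) (b t) (c t) x - quad k a0 b0 c0 x
          = (a t - a0) + (b t - b0) * x $ k + (c t - c0) * (x $ k)\<^sup>2"
        by (simp add: quad_def algebra_simps)
      also have "\<bar>\<dots>\<bar> \<le> \<bar>a t - a0\<bar> + \<bar>b t - b0\<bar> * \<bar>x $ k\<bar> + \<bar>c t - c0\<bar> * \<bar>x $ k\<bar>\<^sup>2"
        by (intro order.trans[OF abs_triangle_ineq] add_mono order.trans[OF abs_triangle_ineq]) (simp_all add: abs_mult)
      also have "\<dots> \<le> ?g t" using x by (intro add_mono mult_left_mono power_mono) auto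
      finally show "dist (quad k (a t) (b t) (c t) x) (quad k a0 b0 c0 x) < e"
        using elim by (simp add: dist_real_def)
    qed
  qed
qed

section \<open>Rescaling diffeomorphisms and the limit\<close>

definition scal :: "(7 \<Rightarrow> real) \<Rightarrow> real^7 \<Rightarrow> real^7" where
  "scal s x = (\<chi> k. s k * x $ k)"

lemma scal_component: "(\<lambda>x. scal s x $ k) = quad k 0 (s k) 0"
  by (simp add: fun_eq_iff scal_def quad_def)

lemma smooth_map_scal: "smooth_map (scal s)"
  by (simp add: smooth_map_def scal_component smooth_fun_quad)

lemma diffeo_scal:
  assumes "\<And>k. s k \<noteq> 0"
  shows "diffeo (scal s)"
proof -
  have inv: "scal s \<circ> scal (\<lambda>k. 1 / s k) = id" "scal (\<lambda>k. 1 / s k) \<circ> scal s = id"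
    using assms by (auto simp: fun_eq_iff scal_def Finite_Cartesian_Product.vec_eq_iff)
  have "inv_into UNIV (scal s) = scal (\<lambda>k. 1 / s k)" by (rule inv_unique_comp[OF inv])
  then show ?thesis
    unfolding diffeo_def using o_bij[OF inv(2,1)] smooth_map_scal by simp
qed

text \<open>With \<open>f = r\<^sup>2\<close>, rescaling by \<open>sphi r\<close> pulls \<open>e\<^sup>5\<close> back to
  \<open>r (dx\<^sup>5 + r\<^bsup>-5\<^esup> x\<^sub>1 dx\<^sup>2)\<close> and \<open>e\<^sup>6\<close> likewise, so every entry of the rescaled
  metric is a quadratic polynomial in \<open>x\<^sub>1\<close> whose nonconstant coefficients decay.\<close>
definition sphi :: "real \<Rightarrow> 7 \<Rightarrow> real" where
  "sphi r i = (if i \<in> {1, 2, 3} then 1 / r\<^sup>2 else r)"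

lemma sphi_simps:
  "sphi r 1 = 1 / r\<^sup>2" "sphi r 2 = 1 / r\<^sup>2" "sphi r 3 = 1 / r\<^sup>2"
  "sphi r 4 = r" "sphi r 5 = r" "sphi r 6 = r" "sphi r 7 = r"
  by (simp_all add: sphi_def)

lemma pullback_entry:
  assumes r: "r > 0"
  shows "pullback_metric (scal (sphi r)) (linv_metric (diagm (dphi (r\<^sup>2)))) x $ i $ j
    = quad 1 (if i = j then 1 else 0)
        (if (i, j) \<in> {(2, 5), (5, 2), (3, 6), (6, 3)} then 1 / r ^ 5 else 0)
        (if (i, j) \<in> {(2, 2), (3, 3)} then 1 / r ^ 10 else 0) x"
proof -
  let ?c = "\<lambda>i. n2_coframe (scal (sphi r) x) (\<chi> k. if i = k then sphi r k else 0)"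
  \<comment> \<open>Components of the i-th coordinate vector in the orthonormal coframe of the
    pulled-back metric, because \<open>dphi (r\<^sup>2) a\<close> times the square of
    \<open>sphi r a\<close> is 1. The metric is then the Gram matrix of these rows.\<close>
  define w :: "7 \<Rightarrow> 7 \<Rightarrow> real" where
    "w i a = (if i = a then 1 else if (i, a) \<in> {(2, 5), (3, 6)} then x $ 1 / r ^ 5 else 0)" for i a
  \<comment> \<open>Both x_1 and the directions 2, 3 are scaled by r^-2, giving r^-4; extracting the
    factor r of e^5 and e^6 leaves r^-5.\<close>
  have r5: "x $ 1 / (r\<^sup>2 * r\<^sup>2) = r * (x $ 1 / r ^ 5)"
    using r by (simp add: eval_nat_numeral)
  have c: "?c i $ a = sphi r a * w i a" for i a
  proof -
    have "?c i $ a = (if i = a then sphi r a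
        else if (i, a) \<in> {(2, 5), (3, 6)} then x $ 1 / (r\<^sup>2 * r\<^sup>2) else 0)"
      by (simp add: n2_coframe_def scal_def sphi_simps cong: if_cong)
    also have "\<dots> = sphi r a * w i a"
      unfolding r5 by (auto simp: w_def sphi_simps)
    finally show ?thesis .
  qed
  have "(\<chi> k. pd i (\<lambda>z. scal (sphi r) z $ k) x) = (\<chi> k. if i = k then sphi r k else 0)" for i
    unfolding scal_component pd_quad by (simp add: Finite_Cartesian_Product.vec_eq_iff quad_def)
  then have "pullback_metric (scal (sphi r)) (linv_metric (diagm (dphi (r\<^sup>2)))) x $ i $ j
    = (\<Sum>a\<in>UNIV. dphi (r\<^sup>2) a * ?c i $ a * ?c j $ a)"
    by (simp add: pullback_metric_def linv_metric_def inner_diagm)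
  also have "\<dots> = (\<Sum>a\<in>UNIV. w i a * w j a)"
  proof (intro sum.cong refl)
    fix a
    have "dphi (r\<^sup>2) a * (sphi r a * sphi r a) = 1"
      using r by (simp add: dphi_def sphi_def power2_eq_square)
    then show "dphi (r\<^sup>2) a * ?c i $ a * ?c j $ a = w i a * w j a"
      unfolding c by (metis (no_types, lifting) mult.assoc mult.left_commute mult_1)
  qed
  also have "\<dots> = quad 1 (if i = j then 1 else 0)
        (if (i, j) \<in> {(2, 5), (5, 2), (3, 6), (6, 3)} then 1 / r ^ 5 else 0)
        (if (i, j) \<in> {(2, 2), (3, 3)} then 1 / r ^ 10 else 0) x"
    unfolding sum_7 using exhaust_7[of i] exhaust_7[of j]
    by (elim disjE; hypsubst) (simp_all add: w_def quad_def power2_eq_square flip: power_add)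
  finally show ?thesis .
qed

lemma pd_const: "pd i (\<lambda>x. c) x = 0"
  by (simp add: pd_def)

lemma flat_metric_id: "flat_metric (\<lambda>x. Finite_Cartesian_Product.mat 1)"
proof -
  let ?h = "\<lambda>x :: real^7. Finite_Cartesian_Product.mat 1 :: real^7^7"
  have "(\<lambda>x. ?h x $ i $ j) = quad 1 (?h 0 $ i $ j) 0 0" for i j
    by (simp add: fun_eq_iff quad_def)
  then have "riem_metric ?h"
    using posdef_sym_diagm[of "\<lambda>_. 1"] by (simp add: riem_metric_def smooth_fun_quad diagm_one)
  moreover have "christoffel ?h k i j = (\<lambda>x. 0)" for k i j
    by (simp add: fun_eq_iff christoffel_def pd_const)
  ultimately show ?thesis by (simp add: flat_metric_def riemann_def pd_const)
qed

lemma smooth_convergence: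
  "smooth_conv_compact
     (\<lambda>t. pullback_metric (scal (sphi (sqrt (f2 t)))) (linv_metric (metric_of (phi2t t))))
     (\<lambda>x. Finite_Cartesian_Product.mat 1)"
  unfolding smooth_conv_compact_def
proof (intro allI impI)
  fix K :: "(real^7) set" and "is" and i j :: 7
  assume K: "compact K"
  let ?a = "if i = j then 1 else 0 :: real"
  let ?b = "\<lambda>t. if (i, j) \<in> {(2, 5), (5, 2), (3, 6), (6, 3)} then 1 / sqrt (f2 t) ^ 5 else 0"
  let ?c = "\<lambda>t. if (i, j) \<in> {(2, 2), (3, 3)} then 1 / sqrt (f2 t) ^ 10 else 0"
  have if_lim: "((\<lambda>t. if P then g t else 0) \<longlongrightarrow> 0) at_top" if "(g \<longlongrightarrow> 0) at_top"
    for P and g :: "real \<Rightarrow> real"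
    using that by (cases P) simp_all
  have lim: "(?b \<longlongrightarrow> 0) at_top" "(?c \<longlongrightarrow> 0) at_top"
    unfolding f2_def by (rule if_lim, real_asymp)+
  obtain a' b' c' a0' b0' c0' where q: "(a' \<longlongrightarrow> a0') at_top" "(b' \<longlongrightarrow> b0') at_top" "(c' \<longlongrightarrow> c0') at_top"
    "\<And>t. iter_pd is (quad 1 ?a (?b t) (?c t)) = quad 1 (a' t) (b' t) (c' t)"
    "iter_pd is (quad 1 ?a 0 0) = quad 1 a0' b0' c0'"
    using iter_pd_quad[OF tendsto_const[where k = ?a] lim, of "is" 1] by blast
  \<comment> \<open>The entry formula relies on \<open>f2 t\<close> being positive, known for t >
    -3/10, so the identity is stated eventually.\<close>
  have ev: "\<forall>\<^sub>F t in at_top. quad 1 (a' t) (b' t) (c' t)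
    = iter_pd is (\<lambda>y. pullback_metric (scal (sphi (sqrt (f2 t)))) (linv_metric (metric_of (phi2t t))) y $ i $ j)"
    using eventually_gt_at_top[of "-3/10 :: real"]
  proof eventually_elim
    case (elim t)
    note f = f2_pos[OF elim]
    have "metric_of (phi2t t) = diagm (dphi ((sqrt (f2 t))\<^sup>2))"
      using f metric_of_phi[OF f] by (simp add: phi2t_eq_lin)
    then have "(\<lambda>y. pullback_metric (scal (sphi (sqrt (f2 t)))) (linv_metric (metric_of (phi2t t))) y $ i $ j)
      = quad 1 ?a (?b t) (?c t)"
      using pullback_entry[of "sqrt (f2 t)"] f by (intro ext) simp
    then show ?case using q(4)[of t] by simp
  qed
  have h: "(\<lambda>y :: real^7. (Finite_Cartesian_Product.mat 1 :: real^7^7) $ i $ j) = quad 1 ?a 0 0"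
    by (simp add: fun_eq_iff quad_def Finite_Cartesian_Product.mat_def)
  show "uniform_limit K (\<lambda>t. iter_pd is (\<lambda>y. pullback_metric (scal (sphi (sqrt (f2 t))))
      (linv_metric (metric_of (phi2t t))) y $ i $ j))
    (iter_pd is (\<lambda>y. Finite_Cartesian_Product.mat 1 $ i $ j)) at_top"
    unfolding h q(5)
    by (rule uniform_limit_cong[THEN iffD1, OF _ _ uniform_limit_quad[OF K q(1-3)]])
      (use ev in \<open>auto elim: eventually_mono\<close>)
qed

theorem theorem4p2:
  shows "laplacian_flow_solution phi2t {-3/10<..} phi2 \<and>
    (\<exists>F h. (\<forall>t>-3/10. diffeo (F t)) \<and> flat_metric h \<and>
       smooth_conv_compact
         (\<lambda>t. pullback_metric (F t) (linv_metric (metric_of (phi2t t)))) h)"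
proof (intro conjI exI allI impI)
  fix t :: real assume "t > -3/10"
  \<comment> \<open>This instantiates the map left open by \<open>exI\<close>; the limit metric is
    fixed as the Euclidean one by \<open>flat_metric_id\<close> in the closing step.\<close>
  then show "diffeo (scal (sphi (sqrt (f2 t))))"
    using f2_pos[of t] by (intro diffeo_scal) (simp add: sphi_def)
qed (rule laplacian_flow_phi2t flat_metric_id smooth_convergence)+

end
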